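(* Let $k\ge 2$ be a fixed integer and let $A>(k-1)/k$ be a constant. For each $n$, choose each element of $\{0,1,\ldots,n-1\}$ to be in a random set $\mathcal{A}$ independently with probability $p=p_n\in[p_0,1]$, where $p_0=p_0(n)$ satisfies $$p_0>\sqrt[k]{\frac{A\,k!\,\log n}{n^{k-1}}}.$$ Let $X=X_n$ be the number of $j\in\{0,1,\ldots,n-1\}$ that cannot be written as $j\equiv x_1+\cdots+x_k\pmod n$ with $x_1,\ldots,x_k\in\mathcal{A}$ (repetitions allowed), and let $Y=Y_n$ be a Poisson random variable with mean $\mathbb{E}(X)$. Then $d_{TV}(X,Y)\to 0$ as $n\to\infty$.
   Context: For nonnegative-integer-valued random variables $X,Y$, the total variation distance between their distributions is $d_{TV}(X,Y)=\sup_{B\subseteq\mathbb{Z}_{\ge 0}}|\mathbb{P}(X\in B)-\mathbb{P}(Y\in B)|$. The quantity $n$ is taken large enough that the lower bound on $p_0$ is less than $1$. *)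

theory Defs
  imports "HOL-Probability.Probability" "HOL-Number_Theory.Cong"
begin

definition d_TV :: "nat pmf \<Rightarrow> nat pmf \<Rightarrow> real" where
  "d_TV P Q = (SUP B. \<bar>measure_pmf.prob P B - measure_pmf.prob Q B\<bar>)"

definition random_subset :: "nat \<Rightarrow> real \<Rightarrow> nat set pmf" where
  "random_subset n p =
     map_pmf (\<lambda>f. {i\<in>{..<n}. f i}) (Pi_pmf {..<n} False (\<lambda>_. bernoulli_pmf p))"

definition representable :: "nat \<Rightarrow> nat \<Rightarrow> nat set \<Rightarrow> nat \<Rightarrow> bool" where
  "representable k n S j \<longleftrightarrow>
     (\<exists>x :: nat \<Rightarrow> nat. (\<forall>i<k. x i \<in> S) \<and> [j = (\<Sum>i<k. x i)] (mod n))"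

definition num_missing :: "nat \<Rightarrow> nat \<Rightarrow> nat set \<Rightarrow> nat" where
  "num_missing k n S = card {j\<in>{..<n}. \<not> representable k n S j}"

definition missing_pmf :: "nat \<Rightarrow> nat \<Rightarrow> real \<Rightarrow> nat pmf" where
  "missing_pmf k n p = map_pmf (num_missing k n) (random_subset n p)"

definition mean_pmf :: "nat pmf \<Rightarrow> real" where
  "mean_pmf P = measure_pmf.expectation P real"

text \<open>
  The library's \<open>poisson_pmf\<close> is only specified for positive rate. Mean zero, which occurs
  here when \<open>p = 1\<close>, is the point mass at zero.
\<close>
definition poisson_law :: "real \<Rightarrow> nat pmf" where
  "poisson_law r = (if r > 0 then poisson_pmf r else return_pmf 0)"

lemma pmf_poisson_law:
  assumes "r \<ge> 0"
  shows "pmf (poisson_law r) j = r ^ j / fact j * exp (- r)"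
  using assms by (cases "r = 0") (auto simp: poisson_law_def power_0_left)

end

theory Submission
  imports Defs "HOL-Real_Asymp.Real_Asymp"
begin

text \<open>
  A residue \<open>j\<close> is missing exactly when the random set contains none of the supports of the \<open>k\<close>-tuples
  with sum \<open>j\<close>. Missing is therefore a decreasing event, and decreasing events are positively
  correlated. For such events the Stein-Chen method bounds the distance between the law of \<open>X\<close> and
  the Poisson law of the same mean \<open>r\<close> by the sum of the squared probabilities \<open>q j\<close> plus the sum of
  all covariances, divided by \<open>r\<close> (\<open>stein_chen_decreasing\<close>). It remains to show that the covariances
  are small.

  Let \<open>M = p ^ k * n ^ (k - 1) / fact k\<close>, which is about the expected number of \<open>k\<close>-subsets of the random
  set with a given sum. The probability that \<open>j\<close> is missing is at least the product of the
  probabilities of avoiding the single supports, and Janson's inequality bounds from above the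
  probability that one residue, or both of two residues, are missing. Counting supports and pairs of
  intersecting supports shows that \<open>q j = exp (- M)\<close> and \<open>P(i and j missing) \<le> exp (- 2 * M)\<close> up to
  factors \<open>exp (\<plusminus> d)\<close>, where \<open>d\<close> is of order \<open>M\<^sup>2 / (p * n)\<close>: every coincidence among the summands costs a
  factor \<open>p * n\<close>, because it removes one free element. Each covariance is thus at most of order
  \<open>d * exp (- 2 * M)\<close>, while \<open>r\<close> is about \<open>n * exp (- M)\<close>, and the distance is of order
  \<open>exp (- M) + d * n * exp (- M)\<close> (\<open>d_TV_missing_bound\<close>).

  The hypothesis on \<open>p\<close> says \<open>M > A * ln n\<close>, and \<open>p * n \<ge> n powr (1 / k)\<close>. If also \<open>M \<le> 2 * ln n\<close>, the
  distance is of order \<open>n powr (- A)\<close> plus \<open>n powr (1 - A - 1 / k)\<close> times a power of \<open>ln n\<close>, and it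
  tends to zero because \<open>A > 1 - 1 / k\<close>. If \<open>M > 2 * ln n\<close>, the mean itself tends to zero
  (\<open>mean_missing_supercritical\<close>), so both laws concentrate at zero (\<open>d_TV_missing_le_mean\<close>).
\<close>

section \<open>Expectations over a random subset\<close>

text \<open>
  The expectation of \<open>f\<close> over a random subset of \<open>U\<close> that contains each element independently with
  probability \<open>p\<close>. Written as a finite sum it needs no measurability, and Harris' inequality
  and monotonicity in \<open>p\<close> follow by exposing one element at a time (\<open>bexp_insert\<close>).
\<close>
definition bexp :: "'a set \<Rightarrow> real \<Rightarrow> ('a set \<Rightarrow> real) \<Rightarrow> real" where
  "bexp U p f = (\<Sum>S\<in>Pow U. p ^ card S * (1 - p) ^ card (U - S) * f S)"

lemma bexp_empty [simp]: "bexp {} p f = f {}"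
  by (simp add: bexp_def)

lemma bexp_insert:
  assumes "finite U" "x \<notin> U"
  shows "bexp (insert x U) p f = p * bexp U p (\<lambda>S. f (insert x S)) + (1 - p) * bexp U p f"
proof -
  have inj: "inj_on (insert x) (Pow U)"
    using assms by (auto simp: inj_on_def)
  have disj: "Pow U \<inter> insert x ` Pow U = {}"
    using assms by auto
  have "bexp (insert x U) p f =
     (\<Sum>S\<in>Pow U. p ^ card S * (1 - p) ^ card (insert x U - S) * f S)
     + (\<Sum>S\<in>insert x ` Pow U. p ^ card S * (1 - p) ^ card (insert x U - S) * f S)"
    unfolding bexp_def Pow_insert using assms disj by (subst sum.union_disjoint) auto
  also have "(\<Sum>S\<in>Pow U. p ^ card S * (1 - p) ^ card (insert x U - S) * f S) = (1 - p) * bexp U p f"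
  proof -
    have "card (insert x U - S) = Suc (card (U - S))" if "S \<in> Pow U" for S
    proof -
      have "insert x U - S = insert x (U - S)" using that assms by auto
      then show ?thesis using assms by simp
    qed
    then show ?thesis unfolding bexp_def sum_distrib_left
      by (intro sum.cong) (auto simp: mult_ac)
  qed
  also have "(\<Sum>S\<in>insert x ` Pow U. p ^ card S * (1 - p) ^ card (insert x U - S) * f S)
      = p * bexp U p (\<lambda>S. f (insert x S))"
  proof -
    have "card (insert x S) = Suc (card S) \<and> insert x U - insert x S = U - S" if "S \<in> Pow U" for S
      using that assms by (auto intro!: card_insert_disjoint intro: finite_subset)
    then show ?thesis unfolding bexp_def sum_distrib_left sum.reindex[OF inj] o_def
      by (intro sum.cong) (auto simp: mult_ac)
  qed
  finally show ?thesis by simp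
qed

lemma bexp_cong: "(\<And>S. S \<subseteq> U \<Longrightarrow> f S = g S) \<Longrightarrow> bexp U p f = bexp U p g"
  by (auto simp: bexp_def intro!: sum.cong)

lemma bexp_add: "bexp U p (\<lambda>S. f S + g S) = bexp U p f + bexp U p g"
  by (simp add: bexp_def distrib_left sum.distrib)

lemma bexp_cmult: "bexp U p (\<lambda>S. c * f S) = c * bexp U p f"
  by (simp add: bexp_def sum_distrib_left mult_ac)

lemma bexp_diff: "bexp U p (\<lambda>S. f S - g S) = bexp U p f - bexp U p g"
  by (simp add: bexp_def right_diff_distrib sum_subtractf)

lemma bexp_sum: "bexp U p (\<lambda>S. \<Sum>i\<in>I. f i S) = (\<Sum>i\<in>I. bexp U p (f i))"
  unfolding bexp_def by (subst sum.swap) (simp add: sum_distrib_left)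

lemma bexp_const:
  assumes "finite U"
  shows "bexp U p (\<lambda>_. c) = c"
  using assms by (induction U) (simp_all add: bexp_insert algebra_simps)

lemma bexp_mono:
  assumes "0 \<le> p" "p \<le> 1" "\<And>S. S \<subseteq> U \<Longrightarrow> f S \<le> g S"
  shows "bexp U p f \<le> bexp U p g"
  unfolding bexp_def using assms by (intro sum_mono mult_left_mono) auto

lemma bexp_nonneg:
  assumes "0 \<le> p" "p \<le> 1" "\<And>S. S \<subseteq> U \<Longrightarrow> 0 \<le> f S"
  shows "0 \<le> bexp U p f"
  unfolding bexp_def using assms by (intro sum_nonneg mult_nonneg_nonneg) auto

lemma expectation_random_subset:
  fixes f :: "nat set \<Rightarrow> real"
  assumes "0 \<le> p" "p \<le> 1" "finite U"
  shows "measure_pmf.expectation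
     (map_pmf (\<lambda>h. {i\<in>U. h i}) (Pi_pmf U False (\<lambda>_. bernoulli_pmf p))) f = bexp U p f"
  using assms(3)
proof (induction U arbitrary: f)
  case empty
  then show ?case by (simp)
next
  case (insert x U)
  let ?P = "Pi_pmf U False (\<lambda>_. bernoulli_pmf p)"
  have fin: "finite (set_pmf ?P)" using insert.hyps by (auto simp: set_Pi_pmf intro!: finite_PiE_dflt)
  have eq: "{i \<in> insert x U. (h(x := b)) i} = (if b then insert x {i\<in>U. h i} else {i\<in>U. h i})" for h :: "nat \<Rightarrow> bool" and b
    using insert.hyps by auto
  have "map_pmf (\<lambda>h. {i \<in> insert x U. h i}) (Pi_pmf (insert x U) False (\<lambda>_. bernoulli_pmf p))
    = bind_pmf (bernoulli_pmf p) (\<lambda>b. map_pmf (\<lambda>h. if b then insert x {i\<in>U. h i} else {i\<in>U. h i}) ?P)"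
    using insert.hyps
    by (simp add: Pi_pmf_insert pair_pmf_def map_bind_pmf bind_map_pmf map_pmf_comp bind_assoc_pmf bind_return_pmf eq[symmetric] map_pmf_def[symmetric])
  then have "measure_pmf.expectation (map_pmf (\<lambda>h. {i \<in> insert x U. h i})
      (Pi_pmf (insert x U) False (\<lambda>_. bernoulli_pmf p))) f =
    (\<Sum>b\<in>UNIV. pmf (bernoulli_pmf p) b * measure_pmf.expectation
      (map_pmf (\<lambda>h. if b then insert x {i\<in>U. h i} else {i\<in>U. h i}) ?P) f)"
    using fin by (simp only:) (subst pmf_expectation_bind[where A = UNIV], auto)
  also have "\<dots> = p * measure_pmf.expectation (map_pmf (\<lambda>h. {i\<in>U. h i}) ?P) (\<lambda>S. f (insert x S))
      + (1 - p) * measure_pmf.expectation (map_pmf (\<lambda>h. {i\<in>U. h i}) ?P) f"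
    using assms by (simp add: UNIV_bool)
  finally show ?case
    using insert.hyps insert.IH[of f] insert.IH[of "\<lambda>S. f (insert x S)"] by (simp only: bexp_insert not_False_eq_True)
qed

lemma antimono_insert:
  fixes f :: "'a set \<Rightarrow> real"
  assumes "antimono f"
  shows "antimono (\<lambda>S. f (insert x S))"
  by (intro antimonoI antimonoD[OF assms]) auto

text \<open>
  Harris' correlation inequality. After conditioning on whether \<open>x\<close> is chosen, the induction
  hypothesis handles both branches, and what remains is that the two conditional means of \<open>f\<close> are
  ordered in the same way as those of \<open>g\<close>.
\<close>
lemma bexp_harris:
  assumes "0 \<le> p" "p \<le> 1" "finite U" "antimono f" "antimono g"
  shows "bexp U p f * bexp U p g \<le> bexp U p (\<lambda>S. f S * g S)"
  using assms(3-5)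
proof (induction U arbitrary: f g)
  case empty
  then show ?case by simp
next
  case (insert x U)
  have a: "antimono (\<lambda>S. h (insert x S))" if "antimono h" for h :: "'a set \<Rightarrow> real"
    using that by (rule antimono_insert)
  have le: "bexp U p (\<lambda>S. h (insert x S)) \<le> bexp U p h" if "antimono h" for h
    by (intro bexp_mono assms antimonoD[OF that]) auto
  define f1 f0 g1 g0 where "f1 = bexp U p (\<lambda>S. f (insert x S))" "f0 = bexp U p f"
    "g1 = bexp U p (\<lambda>S. g (insert x S))" "g0 = bexp U p g"
  note d = this
  have "0 \<le> p * (1 - p) * ((f0 - f1) * (g0 - g1))"
    using assms le insert.prems by (intro mult_nonneg_nonneg) (auto simp: d)
  then have "(p * f1 + (1 - p) * f0) * (p * g1 + (1 - p) * g0) \<le> p * (f1 * g1) + (1 - p) * (f0 * g0)"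
    by (simp add: algebra_simps)
  also have "\<dots> \<le> p * bexp U p (\<lambda>S. f (insert x S) * g (insert x S)) + (1 - p) * bexp U p (\<lambda>S. f S * g S)"
    unfolding d using insert.IH insert.prems a assms by (intro add_mono mult_left_mono) auto
  finally show ?case using insert.hyps by (simp add: bexp_insert d)
qed

lemma bexp_antimono_prob:
  assumes "0 \<le> p" "p \<le> q" "q \<le> 1" "finite U" "antimono f"
  shows "bexp U q f \<le> bexp U p f"
  using assms(4-5)
proof (induction U arbitrary: f)
  case empty
  then show ?case by simp
next
  case (insert x U)
  have a: "antimono (\<lambda>S. f (insert x S))"
    using insert.prems by (rule antimono_insert)
  have le: "bexp U p (\<lambda>S. f (insert x S)) \<le> bexp U p f"
    using assms by (intro bexp_mono antimonoD[OF insert.prems]) auto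
  have "q * bexp U q (\<lambda>S. f (insert x S)) + (1 - q) * bexp U q f
      \<le> q * bexp U p (\<lambda>S. f (insert x S)) + (1 - q) * bexp U p f"
    using insert.IH insert.prems a assms by (intro add_mono mult_left_mono) auto
  also have "\<dots> = bexp U p f - q * (bexp U p f - bexp U p (\<lambda>S. f (insert x S)))"
    by (simp add: algebra_simps)
  also have "\<dots> \<le> bexp U p f - p * (bexp U p f - bexp U p (\<lambda>S. f (insert x S)))"
    using le assms by (intro diff_left_mono mult_right_mono) auto
  finally show ?case using insert.hyps by (simp add: bexp_insert algebra_simps)
qed

text \<open>
  Conditioning on \<open>S \<subseteq> A\<close> amounts to adding \<open>S\<close> to an unconditioned \<open>A\<close>. Both sides of the estimate
  for the probability of avoiding a family rest on this identity.
\<close>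
lemma bexp_superset:
  assumes "finite U" "S \<subseteq> U"
  shows "bexp U p (\<lambda>A. of_bool (S \<subseteq> A) * f A) = p ^ card S * bexp U p (\<lambda>A. f (A \<union> S))"
  using assms
proof (induction U arbitrary: f S)
  case empty
  then show ?case by simp
next
  case (insert x U)
  show ?case
  proof (cases "x \<in> S")
    case True
    define T where "T = S - {x}"
    have S: "S = insert x T" "x \<notin> T" "T \<subseteq> U" using True insert.prems by (auto simp: T_def)
    have fT: "finite T" using S insert.hyps finite_subset by auto
    have "bexp U p (\<lambda>A. of_bool (S \<subseteq> A) * f A) = bexp U p (\<lambda>A. 0)"
      using S insert.hyps by (intro bexp_cong) auto
    moreover have "bexp U p (\<lambda>A. of_bool (S \<subseteq> insert x A) * f (insert x A)) =
       bexp U p (\<lambda>A. of_bool (T \<subseteq> A) * f (insert x A))"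
      using S insert.hyps by (intro bexp_cong) auto
    ultimately show ?thesis
      using insert.hyps insert.IH[of T "\<lambda>A. f (insert x A)"] S fT
      by (simp add: bexp_insert bexp_const insert_commute algebra_simps)
  next
    case False
    then have "S \<subseteq> U" "\<And>A. S \<subseteq> insert x A \<longleftrightarrow> S \<subseteq> A" using insert.prems by auto
    then show ?thesis using insert.hyps insert.IH[of S f] insert.IH[of S "\<lambda>A. f (insert x A)"]
      by (simp add: bexp_insert algebra_simps)
  qed
qed

section \<open>Avoiding a family of sets: a product bound and Janson's inequality\<close>

definition avoids :: "'a set set \<Rightarrow> 'a set \<Rightarrow> real" where
  "avoids F A = of_bool (\<forall>T\<in>F. \<not> T \<subseteq> A)"

lemma avoids_nonneg: "0 \<le> avoids F A"
  by (simp add: avoids_def)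

lemma bexp_avoids_insert:
  assumes "finite U" "S \<subseteq> U"
  shows "bexp U p (avoids (insert S F))
    = bexp U p (avoids F) - p ^ card S * bexp U p (\<lambda>A. avoids F (A \<union> S))"
proof -
  have "avoids (insert S F) = (\<lambda>A. avoids F A - of_bool (S \<subseteq> A) * avoids F A)"
    by (auto simp: avoids_def)
  then show ?thesis using bexp_superset[OF assms] by (simp add: bexp_diff)
qed

lemma bexp_avoids_mono:
  assumes "0 \<le> p" "p \<le> 1" "F \<subseteq> G"
  shows "bexp U p (avoids G) \<le> bexp U p (avoids F)"
  using assms by (intro bexp_mono) (auto simp: avoids_def)

text \<open>
  Avoidance events are positively correlated, so their joint probability is at least the product.
  One set at a time this is seen from \<open>bexp_avoids_insert\<close>: adding \<open>S\<close> to \<open>A\<close> only makes it harder to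
  avoid \<open>F\<close>.
\<close>
lemma bexp_avoids_lower:
  assumes "0 \<le> p" "p \<le> 1" "finite U" "finite F" "\<And>S. S \<in> F \<Longrightarrow> S \<subseteq> U"
  shows "(\<Prod>S\<in>F. 1 - p ^ card S) \<le> bexp U p (avoids F)"
  using assms(4,5)
proof (induction F)
  case empty
  then show ?case using assms by (simp add: avoids_def bexp_const)
next
  case (insert S F)
  have "bexp U p (\<lambda>A. avoids F (A \<union> S)) \<le> bexp U p (avoids F)"
    using assms by (intro bexp_mono) (auto simp: avoids_def)
  then have "p ^ card S * bexp U p (\<lambda>A. avoids F (A \<union> S)) \<le> p ^ card S * bexp U p (avoids F)"
    using assms by (intro mult_left_mono) auto
  then have "(1 - p ^ card S) * bexp U p (avoids F) \<le> bexp U p (avoids (insert S F))"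
    using insert.prems assms by (subst bexp_avoids_insert) (auto simp: algebra_simps)
  moreover have "(1 - p ^ card S) * (\<Prod>S\<in>F. 1 - p ^ card S) \<le> (1 - p ^ card S) * bexp U p (avoids F)"
    using insert assms by (intro mult_left_mono) (auto simp: power_le_one)
  ultimately show ?case using insert.hyps by simp
qed

text \<open>
  The exponential form comes from \<open>ln (1 - x) \<ge> - x - 2 * x\<^sup>2\<close> on \<open>{0..1/2}\<close>, used with
  \<open>x = p ^ card S \<le> p\<close>.
\<close>
lemma bexp_avoids_lower_exp:
  assumes "0 \<le> p" "p \<le> 1/2" "finite U" "finite F" "\<And>S. S \<in> F \<Longrightarrow> S \<subseteq> U \<and> S \<noteq> {}"
  shows "exp (- ((1 + 2 * p) * (\<Sum>S\<in>F. p ^ card S))) \<le> bexp U p (avoids F)"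
proof -
  have "exp (- ((1 + 2 * p) * (\<Sum>S\<in>F. p ^ card S))) = (\<Prod>S\<in>F. exp (- ((1 + 2 * p) * p ^ card S)))"
    using assms by (simp only: sum_distrib_left sum_negf [symmetric] exp_sum)
  also have "\<dots> \<le> (\<Prod>S\<in>F. 1 - p ^ card S)"
  proof (intro prod_mono conjI exp_ge_zero)
    fix S assume "S \<in> F"
    then have "card S > 0" using assms by (metis card_gt_0_iff finite_subset)
    then have "p ^ card S \<le> p ^ 1" using assms by (intro power_decreasing) auto
    then have x: "0 \<le> p ^ card S" "p ^ card S \<le> p" "p ^ card S \<le> 1/2" using assms by auto
    have "- ((1 + 2 * p) * p ^ card S) \<le> - (p ^ card S) - 2 * (p ^ card S)\<^sup>2"
      using x assms by (simp add: algebra_simps power2_eq_square mult_right_mono)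
    also have "\<dots> \<le> ln (1 - p ^ card S)" using x by (intro ln_one_minus_pos_lower_bound) auto
    finally show "exp (- ((1 + 2 * p) * p ^ card S)) \<le> 1 - p ^ card S"
      using x by (subst (asm) ln_ge_iff) auto
  qed
  also have "\<dots> \<le> bexp U p (avoids F)" using assms by (intro bexp_avoids_lower) auto
  finally show ?thesis .
qed

text \<open>
  Janson's \<open>\<Delta>\<close>, a sum over ordered pairs of distinct intersecting members, so that each unordered
  pair counts twice.
\<close>
definition overlap :: "real \<Rightarrow> 'a set set \<Rightarrow> real" where
  "overlap p F = (\<Sum>S\<in>F. \<Sum>T | T \<in> F \<and> T \<noteq> S \<and> S \<inter> T \<noteq> {}. p ^ card (S \<union> T))"

lemma overlap_insert:
  assumes "finite F" "S \<notin> F"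
  shows "overlap p (insert S F) = overlap p F + 2 * (\<Sum>T | T \<in> F \<and> S \<inter> T \<noteq> {}. p ^ card (S \<union> T))"
proof -
  define w where "w S T = (if T \<noteq> S \<and> S \<inter> T \<noteq> {} then p ^ card (S \<union> T) else 0)" for S T :: "'a set"
  have ov: "overlap p G = (\<Sum>S\<in>G. \<Sum>T\<in>G. w S T)" if "finite G" for G
    unfolding overlap_def w_def using that by (simp add: sum.inter_filter)
  have sy: "(\<Sum>T\<in>F. w T S) = (\<Sum>T\<in>F. w S T)"
    by (intro sum.cong) (auto simp: w_def Int_commute Un_commute)
  have "w S S = 0" by (simp add: w_def)
  then have "overlap p (insert S F) = overlap p F + 2 * (\<Sum>T\<in>F. w S T)"
    using assms by (simp add: ov sum.distrib sy)
  also have "(\<Sum>T\<in>F. w S T) = (\<Sum>T | T \<in> F \<and> S \<inter> T \<noteq> {}. p ^ card (S \<union> T))"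
    unfolding w_def using assms by (subst sum.inter_filter) (auto intro!: sum.cong)
  finally show ?thesis .
qed

text \<open>
  Janson's inequality, by the argument of Boppana and Spencer. When \<open>S\<close> joins \<open>F\<close>, the members of \<open>F\<close>
  disjoint from \<open>S\<close> are independent of the event \<open>S \<subseteq> A\<close>, while each member \<open>T\<close> meeting \<open>S\<close> costs at most
  \<open>p ^ card (S \<union> T)\<close>. Hence the avoidance probability shrinks at least by the factor \<open>1 - b \<le> exp (- b)\<close>,
  where \<open>b\<close> is \<open>p ^ card S\<close> minus these costs.
\<close>
theorem janson:
  assumes "0 \<le> p" "p \<le> 1" "finite U" "finite F" "\<And>S. S \<in> F \<Longrightarrow> S \<subseteq> U"
  shows "bexp U p (avoids F) \<le> exp (- (\<Sum>S\<in>F. p ^ card S) + overlap p F / 2)"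
  using assms(4,5)
proof (induction F)
  case empty
  then show ?case using assms by (simp add: avoids_def bexp_const overlap_def)
next
  case (insert S F)
  define F0 where "F0 = {T \<in> F. S \<inter> T \<noteq> {}}"
  define F1 where "F1 = {T \<in> F. S \<inter> T = {}}"
  define b where "b = p ^ card S - (\<Sum>T\<in>F0. p ^ card (S \<union> T))"
  have fin: "finite F0" "finite F1" using insert.hyps by (auto simp: F0_def F1_def)
  have SU: "S \<subseteq> U" using insert by auto
  let ?q = "bexp U p (avoids F)"
  let ?q1 = "bexp U p (avoids F1)"
  let ?r = "p ^ card S * bexp U p (\<lambda>A. avoids F (A \<union> S))"
  have r: "?r = bexp U p (\<lambda>A. of_bool (S \<subseteq> A) * avoids F A)"
    using assms SU by (simp add: bexp_superset)
  have r0: "0 \<le> ?r" using assms by (intro mult_nonneg_nonneg bexp_nonneg avoids_nonneg) auto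
  have "?q1 * b \<le> ?r"
  proof -
    have "bexp U p (\<lambda>A. of_bool (S \<subseteq> A) * avoids F1 A) = p ^ card S * ?q1"
    proof -
      have "avoids F1 (A \<union> S) = avoids F1 A" for A by (auto simp: avoids_def F1_def)
      then show ?thesis using assms SU by (simp add: bexp_superset)
    qed
    moreover have "(\<Sum>T\<in>F0. bexp U p (\<lambda>A. of_bool (S \<union> T \<subseteq> A) * avoids F1 A)) \<le> (\<Sum>T\<in>F0. p ^ card (S \<union> T) * ?q1)"
    proof (intro sum_mono)
      fix T assume "T \<in> F0"
      then have "S \<union> T \<subseteq> U" using insert.prems by (auto simp: F0_def)
      then have "bexp U p (\<lambda>A. of_bool (S \<union> T \<subseteq> A) * avoids F1 A) = p ^ card (S \<union> T) * bexp U p (\<lambda>A. avoids F1 (A \<union> (S \<union> T)))"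
        using assms by (intro bexp_superset)
      also have "\<dots> \<le> p ^ card (S \<union> T) * ?q1"
        using assms by (intro mult_left_mono bexp_mono) (auto simp: avoids_def)
      finally show "bexp U p (\<lambda>A. of_bool (S \<union> T \<subseteq> A) * avoids F1 A) \<le> p ^ card (S \<union> T) * ?q1" .
    qed
    moreover have "bexp U p (\<lambda>A. of_bool (S \<subseteq> A) * avoids F1 A - (\<Sum>T\<in>F0. of_bool (S \<union> T \<subseteq> A) * avoids F1 A)) \<le> ?r"
      unfolding r
    proof (intro bexp_mono assms)
      fix A
      show "of_bool (S \<subseteq> A) * avoids F1 A - (\<Sum>T\<in>F0. of_bool (S \<union> T \<subseteq> A) * avoids F1 A) \<le> of_bool (S \<subseteq> A) * avoids F A"
      proof (cases "\<exists>T\<in>F0. T \<subseteq> A \<and> S \<subseteq> A")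
        case True
        then obtain T where T: "T \<in> F0" "T \<subseteq> A" "S \<subseteq> A" by auto
        then have "avoids F1 A \<le> (\<Sum>T\<in>F0. of_bool (S \<union> T \<subseteq> A) * avoids F1 A)"
          using fin member_le_sum[of T F0 "\<lambda>T. of_bool (S \<union> T \<subseteq> A) * avoids F1 A"] by (auto simp: avoids_nonneg)
        then show ?thesis using T avoids_nonneg[of F A] by simp
      next
        case False
        then have "of_bool (S \<subseteq> A) * avoids F1 A = of_bool (S \<subseteq> A) * avoids F A"
          by (auto simp: avoids_def F1_def F0_def)
        then show ?thesis by (simp add: sum_nonneg avoids_nonneg)
      qed
    qed
    ultimately show ?thesis by (simp add: bexp_diff bexp_sum b_def right_diff_distrib sum_distrib_left mult.commute)
  qed
  \<comment> \<open>If \<open>b\<close> is negative, the bound below holds because its left side is at most zero.\<close>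
  moreover have "?q \<le> ?q1" using assms by (intro bexp_avoids_mono) (auto simp: F1_def)
  moreover have "0 \<le> ?q" using assms by (intro bexp_nonneg avoids_nonneg)
  ultimately have "?q * b \<le> ?r"
    using r0 mult_nonneg_nonpos[of ?q b] mult_right_mono[of ?q ?q1 b]
    by (cases "0 \<le> b") auto
  then have "bexp U p (avoids (insert S F)) \<le> ?q * (1 - b)"
    using assms SU by (simp add: bexp_avoids_insert algebra_simps)
  also have "\<dots> \<le> ?q * exp (- b)"
    using \<open>0 \<le> ?q\<close> exp_ge_add_one_self[of "-b"] by (intro mult_left_mono) auto
  also have "\<dots> \<le> exp (- (\<Sum>S\<in>F. p ^ card S) + overlap p F / 2) * exp (- b)"
    using insert by (intro mult_right_mono) auto
  also have "\<dots> = exp (- (\<Sum>S\<in>insert S F. p ^ card S) + overlap p (insert S F) / 2)"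
    using insert.hyps by (simp add: overlap_insert b_def F0_def flip: exp_add)
  finally show ?case .
qed

section \<open>The Stein equation of the Poisson law\<close>

definition pois :: "real \<Rightarrow> nat \<Rightarrow> real" where
  "pois r m = r ^ m / fact m * exp (- r)"

text \<open>
  The solution of the Stein equation for the set \<open>B\<close>, shifted by one: \<open>stein r B m\<close> is the value
  that is usually written \<open>g (m + 1)\<close>. At \<open>m = 0\<close> the truncated \<open>m - 1\<close> in \<open>stein_equation\<close> is
  harmless because of the factor \<open>m\<close>.
\<close>
definition stein :: "real \<Rightarrow> nat set \<Rightarrow> nat \<Rightarrow> real" where
  "stein r B m = (measure_pmf.prob (poisson_law r) (B \<inter> {..m})
     - measure_pmf.prob (poisson_law r) B * measure_pmf.prob (poisson_law r) {..m}) / (r * pois r m)"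

context
  fixes r :: real
  assumes r: "r > 0"
begin

lemma pois_pos: "pois r m > 0"
  using r by (simp add: pois_def)

lemma pois_Suc: "pois r (Suc m) = r / real (Suc m) * pois r m"
  by (simp add: pois_def field_simps)

lemma pmf_poisson_law': "pmf (poisson_law r) m = pois r m"
  using r by (simp add: pmf_poisson_law pois_def)

lemma pois_sums: "pois r sums 1"
proof -
  have "(\<lambda>m. r ^ m / fact m) sums exp r"
    using exp_converges[of r] by (simp add: divide_inverse mult_ac)
  then have "(\<lambda>m. r ^ m / fact m * exp (- r)) sums (exp r * exp (- r))"
    by (rule sums_mult2)
  then show ?thesis by (simp add: pois_def[abs_def] exp_minus_inverse)
qed

lemma prob_atMost: "measure_pmf.prob (poisson_law r) {..m} = (\<Sum>i\<le>m. pois r i)"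
  by (simp add: measure_measure_pmf_finite pmf_poisson_law')

lemma pois_tail: "1 - (\<Sum>i\<le>m. pois r i) = (\<Sum>i. pois r (i + Suc m))"
proof -
  have "suminf (pois r) = (\<Sum>i. pois r (i + Suc m)) + (\<Sum>i<Suc m. pois r i)"
    using pois_sums by (intro suminf_split_initial_segment) (auto simp: sums_iff)
  then show ?thesis using pois_sums by (simp add: sums_iff lessThan_Suc_atMost)
qed

text \<open>
  Since \<open>(i + 1) * pois r (i + 1) = r * pois r i\<close>, shifting the index by one multiplies each term with
  \<open>i \<le> m\<close> by at least \<open>r / (m + 1)\<close>, and each term with \<open>i > m\<close> by at most that. This lemma and
  \<open>pois_tail_shift\<close> say that \<open>P{..m} / pois r m\<close> increases and \<open>P{m<..} / pois r m\<close> decreases in \<open>m\<close>.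
\<close>
lemma pois_head_shift: "r / real (Suc m) * (\<Sum>i\<le>m. pois r i) \<le> (\<Sum>i\<le>Suc m. pois r i)"
proof -
  have "r / real (Suc m) * (\<Sum>i\<le>m. pois r i) \<le> (\<Sum>i\<le>m. pois r (Suc i))"
    unfolding sum_distrib_left pois_Suc using r pois_pos
    by (intro sum_mono mult_right_mono divide_left_mono) (auto intro: less_imp_le)
  also have "\<dots> \<le> (\<Sum>i\<le>Suc m. pois r i)"
    using pois_pos[of 0] by (subst sum.atMost_Suc_shift) simp
  finally show ?thesis .
qed

lemma pois_tail_shift: "1 - (\<Sum>i\<le>Suc m. pois r i) \<le> r / real (Suc m) * (1 - (\<Sum>i\<le>m. pois r i))"
proof -
  have s: "summable (pois r)" using pois_sums by (simp add: sums_iff)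
  have s': "summable (\<lambda>i. pois r (i + k))" for k using s by (subst summable_iff_shift)
  have "(\<Sum>i. pois r (i + Suc (Suc m))) \<le> (\<Sum>i. r / real (Suc m) * pois r (i + Suc m))"
  proof (intro suminf_le s' summable_mult)
    fix i
    have "pois r (i + Suc (Suc m)) = r / real (Suc (i + Suc m)) * pois r (i + Suc m)"
      using pois_Suc[of "i + Suc m"] by simp
    also have "\<dots> \<le> r / real (Suc m) * pois r (i + Suc m)"
      using r pois_pos by (intro mult_right_mono divide_left_mono) (auto intro: less_imp_le)
    finally show "pois r (i + Suc (Suc m)) \<le> r / real (Suc m) * pois r (i + Suc m)" .
  qed
  then show ?thesis unfolding pois_tail using s' by (simp only: suminf_mult)
qed

lemma stein_equation:
  "r * stein r B m - real m * stein r B (m - 1) = indicator B m - measure_pmf.prob (poisson_law r) B"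
proof (cases m)
  case 0
  have "measure_pmf.prob (poisson_law r) (B \<inter> {..0}) = indicator B 0 * pois r 0"
    by (cases "0 \<in> B") (auto simp: measure_pmf_single pmf_poisson_law')
  then show ?thesis using r pois_pos[of 0] 0
    by (simp add: stein_def measure_pmf_single pmf_poisson_law' field_simps)
next
  case (Suc l)
  have "B \<inter> {..Suc l} = (B \<inter> {..l}) \<union> (B \<inter> {Suc l})" by auto
  then have "measure_pmf.prob (poisson_law r) (B \<inter> {..Suc l}) =
      measure_pmf.prob (poisson_law r) (B \<inter> {..l}) + measure_pmf.prob (poisson_law r) (B \<inter> {Suc l})"
    by (simp only:) (intro measure_pmf.finite_measure_Union, auto)
  also have "measure_pmf.prob (poisson_law r) (B \<inter> {Suc l}) = indicator B (Suc l) * pois r (Suc l)"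
    by (cases "Suc l \<in> B") (auto simp: measure_pmf_single pmf_poisson_law')
  finally have x: "measure_pmf.prob (poisson_law r) (B \<inter> {..Suc l}) =
      measure_pmf.prob (poisson_law r) (B \<inter> {..l}) + indicator B (Suc l) * pois r (Suc l)" .
  define c where "c = measure_pmf.prob (poisson_law r) (B \<inter> {..l})
     - measure_pmf.prob (poisson_law r) B * measure_pmf.prob (poisson_law r) {..l}"
  define d where "d = indicator B (Suc l) - measure_pmf.prob (poisson_law r) B"
  have "r * pois r l = real (Suc l) * pois r (Suc l)" by (simp add: pois_Suc)
  then have "real (Suc l) * stein r B l = c / pois r (Suc l)"
    by (simp only: stein_def c_def[symmetric]) simp
  moreover have "r * stein r B (Suc l) = (c + pois r (Suc l) * d) / pois r (Suc l)"
  proof -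
    have "r * stein r B (Suc l) = (measure_pmf.prob (poisson_law r) (B \<inter> {..Suc l})
     - measure_pmf.prob (poisson_law r) B * measure_pmf.prob (poisson_law r) {..Suc l}) / pois r (Suc l)"
      using r by (simp add: stein_def)
    also have "measure_pmf.prob (poisson_law r) {..Suc l} = measure_pmf.prob (poisson_law r) {..l} + pois r (Suc l)"
      by (simp add: prob_atMost)
    finally show ?thesis by (simp add: x c_def d_def algebra_simps)
  qed
  moreover have "(c + pois r (Suc l) * d) / pois r (Suc l) - c / pois r (Suc l) = d"
    using pois_pos[of "Suc l"] by (simp add: field_simps)
  ultimately show ?thesis using Suc d_def by simp
qed

lemma stein_compl: "stein r (- B) m = - stein r B m"
proof -
  have "measure_pmf.prob (poisson_law r) (- B) = 1 - measure_pmf.prob (poisson_law r) B"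
    using measure_pmf.prob_compl[of B "poisson_law r"] by (simp add: Compl_eq_Diff_UNIV)
  moreover have "measure_pmf.prob (poisson_law r) (- B \<inter> {..m})
      = measure_pmf.prob (poisson_law r) {..m} - measure_pmf.prob (poisson_law r) (B \<inter> {..m})"
    by (subst measure_pmf.finite_measure_Diff [symmetric]) (auto intro!: arg_cong[where f="measure_pmf.prob (poisson_law r)"])
  ultimately have "measure_pmf.prob (poisson_law r) (- B \<inter> {..m})
      - measure_pmf.prob (poisson_law r) (- B) * measure_pmf.prob (poisson_law r) {..m}
    = - (measure_pmf.prob (poisson_law r) (B \<inter> {..m})
      - measure_pmf.prob (poisson_law r) B * measure_pmf.prob (poisson_law r) {..m})"
    by (simp only:) (simp add: algebra_simps)
  then show ?thesis by (simp only: stein_def minus_divide_left)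
qed

text \<open>
  The smoothness estimate behind the factor \<open>1 / r\<close> in the Stein-Chen bound. Write the solution as
  \<open>P (B \<inter> {..m}) * b m - P (B \<inter> {m<..}) * a m\<close> with \<open>a\<close> increasing and \<open>b\<close> decreasing. In the increment,
  all mass of \<open>B\<close> away from \<open>Suc m\<close> contributes nonpositively. What is left is the jump at \<open>Suc m\<close>, and
  replacing \<open>a m\<close> there by the larger \<open>a (Suc m)\<close> turns it into \<open>(P{Suc m<..} + P{..Suc m}) / r\<close>.
\<close>
lemma stein_increment_le: "stein r B (Suc m) - stein r B m \<le> 1 / r"
proof -
  define P where "P = measure_pmf.prob (poisson_law r)"
  define x where "x l = P (B \<inter> {..l})" for l
  define y where "y l = P B - x l" for l
  define U where "U l = (\<Sum>i\<le>l. pois r i)" for l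
  define a where "a l = U l / (r * pois r l)" for l
  define b where "b l = (1 - U l) / (r * pois r l)" for l
  define e where "e = (indicator B (Suc m) :: real)"
  have s: "stein r B l = x l * b l - y l * a l" for l
    by (simp add: stein_def prob_atMost x_def y_def a_def b_def U_def P_def field_simps
      flip: diff_divide_distrib add_divide_distrib)
  have "B \<inter> {..Suc m} = (B \<inter> {..m}) \<union> (B \<inter> {Suc m})" by auto
  then have "P (B \<inter> {..Suc m}) = P (B \<inter> {..m}) + P (B \<inter> {Suc m})"
    unfolding P_def by (simp only:) (intro measure_pmf.finite_measure_Union, auto)
  also have "P (B \<inter> {Suc m}) = e * pois r (Suc m)"
    unfolding P_def e_def by (cases "Suc m \<in> B") (auto simp: measure_pmf_single pmf_poisson_law')
  finally have x: "x (Suc m) = x m + e * pois r (Suc m)" unfolding x_def .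
  have x0: "x m \<ge> 0" by (simp add: x_def P_def)
  have y0: "y (Suc m) \<ge> 0" unfolding y_def x_def P_def
    by (simp, intro measure_pmf.finite_measure_mono) auto
  note pp = pois_pos[of m]
  have ps: "r * pois r (Suc m) = r / real (Suc m) * (r * pois r m)" by (simp add: pois_Suc)
  have rp: "r * pois r m > 0" "r / real (Suc m) > 0" using r pp by auto
  have a: "a m \<le> a (Suc m)"
  proof -
    have "a m = (r / real (Suc m) * U m) / (r * pois r (Suc m))"
      unfolding a_def ps using rp by (subst mult_divide_mult_cancel_left) auto
    also have "\<dots> \<le> U (Suc m) / (r * pois r (Suc m))"
      unfolding U_def using r pois_pos[of "Suc m"] by (intro divide_right_mono pois_head_shift) (auto intro: less_imp_le)
    finally show ?thesis unfolding a_def .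
  qed
  have b: "b (Suc m) \<le> b m"
  proof -
    have "b (Suc m) \<le> (r / real (Suc m) * (1 - U m)) / (r * pois r (Suc m))"
      unfolding b_def U_def using r pois_pos[of "Suc m"] by (intro divide_right_mono pois_tail_shift) (auto intro: less_imp_le)
    also have "\<dots> = b m"
      unfolding b_def ps using rp by (subst mult_divide_mult_cancel_left) auto
    finally show ?thesis .
  qed
  have c: "pois r (Suc m) * (b (Suc m) + a m) \<le> 1 / r"
  proof -
    have "pois r (Suc m) * b (Suc m) = (1 - U (Suc m)) / r"
      using pois_pos[of "Suc m"] r by (simp add: b_def)
    moreover have "pois r (Suc m) * a (Suc m) = U (Suc m) / r"
      using pois_pos[of "Suc m"] r by (simp add: a_def)
    moreover have "pois r (Suc m) * a m \<le> pois r (Suc m) * a (Suc m)"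
      using a pois_pos[of "Suc m"] by simp
    ultimately show ?thesis by (simp add: distrib_left diff_divide_distrib)
  qed
  have "stein r B (Suc m) - stein r B m
      = e * (pois r (Suc m) * (b (Suc m) + a m)) - x m * (b m - b (Suc m)) - y (Suc m) * (a (Suc m) - a m)"
    unfolding s x y_def by (simp add: algebra_simps)
  also have "\<dots> \<le> e * (pois r (Suc m) * (b (Suc m) + a m))"
    using mult_nonneg_nonneg[OF x0, of "b m - b (Suc m)"] mult_nonneg_nonneg[OF y0, of "a (Suc m) - a m"] a b by simp
  also have "\<dots> \<le> 1 / r" using c r by (simp add: e_def indicator_def)
  finally show ?thesis .
qed

text \<open>
  The lower bound is the upper bound for the complement of \<open>B\<close>.
\<close>
lemma stein_increment_abs: "\<bar>stein r B (Suc m) - stein r B m\<bar> \<le> 1 / r"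
  using stein_increment_le[of B m] stein_increment_le[of "- B" m] by (simp add: stein_compl abs_le_iff)

lemma mono_linear_plus_stein:
  "mono (\<lambda>m. real m / r + stein r B m)"
proof (rule mono_iff_le_Suc[THEN iffD2], rule allI)
  fix m
  show "real m / r + stein r B m \<le> real (Suc m) / r + stein r B (Suc m)"
    using stein_increment_abs[of B m] by (simp add: abs_le_iff add_divide_distrib)
qed

end

section \<open>Poisson approximation for decreasing events\<close>

text \<open>
  Stein-Chen approximation for a sum of decreasing events. Let \<open>W j\<close> count the events other than
  \<open>j\<close>. One must compare \<open>q j * E (h (W j))\<close> with \<open>E (I j * h (W j))\<close>. As \<open>h\<close> varies by at most \<open>1 / r\<close>
  per step, both \<open>w / r + h w\<close> and \<open>w / r - h w\<close> are increasing in \<open>w\<close>, so Harris' inequality applies to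
  them and \<open>I j\<close>; it bounds the difference by the covariance of \<open>W j\<close> and \<open>I j\<close>, divided by \<open>r\<close>, and no
  coupling has to be constructed.
\<close>
theorem stein_chen_decreasing:
  fixes p :: real and U :: "'a set" and J :: "'b set" and P :: "'b \<Rightarrow> 'a set \<Rightarrow> bool"
  defines "q \<equiv> \<lambda>j. bexp U p (\<lambda>S. of_bool (P j S))"
  assumes "0 \<le> p" "p \<le> 1" "finite U" "finite J"
    and anti: "\<And>j S T. \<lbrakk>S \<subseteq> T; P j T\<rbrakk> \<Longrightarrow> P j S"
    and r: "r = (\<Sum>j\<in>J. q j)" "r > 0"
  shows "\<bar>bexp U p (\<lambda>S. indicator B (card {j\<in>J. P j S})) - measure_pmf.prob (poisson_law r) B\<bar>
    \<le> ((\<Sum>j\<in>J. (q j)\<^sup>2) + (\<Sum>j\<in>J. \<Sum>i\<in>J - {j}. bexp U p (\<lambda>S. of_bool (P i S) * of_bool (P j S)) - q i * q j)) / r"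
proof -
  define X where "X S = card {j\<in>J. P j S}" for S
  define W where "W j S = card {i\<in>J - {j}. P i S}" for j S
  define I where "I j S = (of_bool (P j S) :: real)" for j S
  define h where "h = stein r B"
  define D where "D j = bexp U p (\<lambda>S. I j S * real (W j S)) - q j * bexp U p (\<lambda>S. real (W j S))" for j
  have q: "q j = bexp U p (I j)" for j by (simp add: q_def I_def[abs_def])
  have q0: "q j \<ge> 0" for j unfolding q I_def using assms by (intro bexp_nonneg) auto
  have antiI: "antimono (I j)" for j
    using anti by (auto simp: antimono_def I_def)
  have antiW: "S \<subseteq> T \<Longrightarrow> W j T \<le> W j S" for j S T
    unfolding W_def using anti assms by (intro card_mono) auto
  have XW: "X S = (if P j S then Suc (W j S) else W j S)" if "j \<in> J" for j S
  proof -
    have "{i\<in>J. P i S} = (if P j S then insert j {i\<in>J - {j}. P i S} else {i\<in>J - {j}. P i S})"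
      using that by auto
    then show ?thesis using assms by (simp add: X_def W_def)
  qed
  have Xsum: "real (X S) = (\<Sum>j\<in>J. I j S)" for S
    using assms by (simp add: X_def I_def sum_of_bool_eq Int_def)
  have Wsum: "real (W j S) = (\<Sum>i\<in>J - {j}. I i S)" for j S
    using assms by (simp add: W_def I_def sum_of_bool_eq Int_def)
  have step1: "\<bar>bexp U p (\<lambda>S. h (X S)) - bexp U p (\<lambda>S. h (W j S))\<bar> \<le> q j / r" if "j \<in> J" for j
  proof -
    have b: "\<bar>h (X S) - h (W j S)\<bar> \<le> I j S * (1 / r)" for S
      using stein_increment_abs[OF r(2), of B "W j S"] XW[OF that, of S] by (auto simp: I_def h_def)
    have "bexp U p (\<lambda>S. h (X S) - h (W j S)) \<le> bexp U p (\<lambda>S. I j S * (1 / r))"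
      using b by (intro bexp_mono assms) (auto simp: abs_le_iff)
    moreover have "bexp U p (\<lambda>S. h (W j S) - h (X S)) \<le> bexp U p (\<lambda>S. I j S * (1 / r))"
      using b by (intro bexp_mono assms) (auto simp: abs_le_iff)
    moreover have "bexp U p (\<lambda>S. I j S * (1 / r)) = q j / r"
      using bexp_cmult[of U p "1 / r" "I j"] by (simp add: q mult_ac)
    ultimately show ?thesis by (simp add: bexp_diff abs_le_iff)
  qed
  have step2: "\<bar>q j * bexp U p (\<lambda>S. h (W j S)) - bexp U p (\<lambda>S. I j S * h (W j S))\<bar> \<le> D j / r" if "j \<in> J" for j
  proof -
    have *: "q j * bexp U p (\<lambda>S. stein r C (W j S)) - bexp U p (\<lambda>S. I j S * stein r C (W j S)) \<le> D j / r" for C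
    proof -
      let ?g = "\<lambda>S. real (W j S) / r + stein r C (W j S)"
      have "antimono ?g"
        by (intro antimonoI monoD[OF mono_linear_plus_stein[OF r(2)]] antiW)
      then have "bexp U p (I j) * bexp U p ?g \<le> bexp U p (\<lambda>S. I j S * ?g S)"
        using antiI assms by (intro bexp_harris)
      also have "(\<lambda>S. I j S * ?g S) = (\<lambda>S. (1 / r) * (I j S * real (W j S)) + I j S * stein r C (W j S))"
        by (simp add: algebra_simps)
      also have "?g = (\<lambda>S. (1 / r) * real (W j S) + stein r C (W j S))" by simp
      finally show ?thesis
        by (simp only: bexp_add bexp_cmult) (simp add: q[symmetric] D_def algebra_simps diff_divide_distrib)
    qed
    have neg: "bexp U p (\<lambda>S. c S * stein r (- B) (W j S)) = - bexp U p (\<lambda>S. c S * stein r B (W j S))" for c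
      using bexp_cmult[of U p "-1"] by (simp add: stein_compl[OF r(2)])
    show ?thesis using *[of B] *[of "- B"] neg[of "I j"] neg[of "\<lambda>_. 1"] by (simp add: h_def abs_le_iff)
  qed
  have "bexp U p (\<lambda>S. indicator B (X S)) - measure_pmf.prob (poisson_law r) B
      = bexp U p (\<lambda>S. indicator B (X S) - measure_pmf.prob (poisson_law r) B)"
    using \<open>finite U\<close> by (simp only: bexp_diff bexp_const)
  also have "\<dots> = bexp U p (\<lambda>S. r * h (X S) - real (X S) * h (X S - 1))"
    unfolding h_def stein_equation[OF r(2)] ..
  also have "\<dots> = bexp U p (\<lambda>S. r * h (X S) - (\<Sum>j\<in>J. I j S * h (W j S)))"
  proof (intro bexp_cong)
    fix S
    have "real (X S) * h (X S - 1) = (\<Sum>j\<in>J. I j S * h (W j S))"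
      unfolding Xsum sum_distrib_right using XW by (intro sum.cong) (auto simp: I_def)
    then show "r * h (X S) - real (X S) * h (X S - 1) = r * h (X S) - (\<Sum>j\<in>J. I j S * h (W j S))" by simp
  qed
  also have "\<dots> = (\<Sum>j\<in>J. q j * bexp U p (\<lambda>S. h (X S)) - bexp U p (\<lambda>S. I j S * h (W j S)))"
    by (simp add: bexp_diff bexp_cmult bexp_sum sum_subtractf r(1) sum_distrib_right)
  finally have "\<bar>bexp U p (\<lambda>S. indicator B (X S)) - measure_pmf.prob (poisson_law r) B\<bar>
     \<le> (\<Sum>j\<in>J. \<bar>q j * bexp U p (\<lambda>S. h (X S)) - bexp U p (\<lambda>S. I j S * h (W j S))\<bar>)"
    by (simp only: sum_abs)
  also have "\<dots> \<le> (\<Sum>j\<in>J. (q j)\<^sup>2 / r + D j / r)"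
  proof (intro sum_mono)
    fix j assume j: "j \<in> J"
    let ?a = "bexp U p (\<lambda>S. h (X S))" and ?b = "bexp U p (\<lambda>S. h (W j S))"
    have "\<bar>q j * ?a - q j * ?b\<bar> = q j * \<bar>?a - ?b\<bar>"
      using q0[of j] by (simp add: abs_mult flip: right_diff_distrib)
    also have "\<dots> \<le> q j * (q j / r)" using step1[OF j] q0 by (intro mult_left_mono)
    finally show "\<bar>q j * ?a - bexp U p (\<lambda>S. I j S * h (W j S))\<bar> \<le> (q j)\<^sup>2 / r + D j / r"
      using step2[OF j] by (simp add: power2_eq_square)
  qed
  also have "\<dots> = ((\<Sum>j\<in>J. (q j)\<^sup>2) + (\<Sum>j\<in>J. D j)) / r"
    by (simp add: sum.distrib sum_divide_distrib add_divide_distrib)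
  also have "(\<Sum>j\<in>J. D j) = (\<Sum>j\<in>J. \<Sum>i\<in>J - {j}. bexp U p (\<lambda>S. of_bool (P i S) * of_bool (P j S)) - q i * q j)"
  proof (intro sum.cong refl)
    fix j
    show "D j = (\<Sum>i\<in>J - {j}. bexp U p (\<lambda>S. of_bool (P i S) * of_bool (P j S)) - q i * q j)"
      unfolding D_def Wsum sum_distrib_left bexp_sum sum_subtractf
      by (simp add: I_def[symmetric] q[symmetric] mult_ac)
  qed
  finally show ?thesis unfolding X_def .
qed

section \<open>Counting representations modulo n\<close>

lemma sum_UN_le:
  fixes g :: "'a \<Rightarrow> real"
  assumes "finite J" "\<And>j. j \<in> J \<Longrightarrow> finite (F j)" "\<And>x. 0 \<le> g x"
  shows "sum g (\<Union>j\<in>J. F j) \<le> (\<Sum>j\<in>J. sum g (F j))"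
  using assms(1,2)
proof (induction J)
  case (insert j J)
  have "sum g (F j \<union> (\<Union>j\<in>J. F j)) = sum g (F j) + sum g (\<Union>j\<in>J. F j) - sum g (F j \<inter> (\<Union>j\<in>J. F j))"
    using insert by (intro sum_Un) auto
  also have "\<dots> \<le> sum g (F j) + (\<Sum>j\<in>J. sum g (F j))"
    using insert sum_nonneg[of "F j \<inter> (\<Union>j\<in>J. F j)" g] assms(3) by force
  finally show ?case using insert.hyps by simp
qed simp

lemma card_PiE_insert_fibres:
  assumes "finite R" "finite B" "r \<notin> R"
  shows "card {x \<in> insert r R \<rightarrow>\<^sub>E B. P x} = (\<Sum>y\<in>R \<rightarrow>\<^sub>E B. card {t\<in>B. P (y(r := t))})"
proof -
  have "{x \<in> insert r R \<rightarrow>\<^sub>E B. P x} = (\<lambda>(y, t). y(r := t)) ` (SIGMA y : R \<rightarrow>\<^sub>E B. {t\<in>B. P (y(r := t))})"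
    (is "?A = ?g ` ?B")
  proof (intro equalityI subsetI)
    fix x assume x: "x \<in> ?A"
    then obtain y t where "x = y(r := t)" "t \<in> B" "y \<in> R \<rightarrow>\<^sub>E B"
      by (auto simp: PiE_insert_eq)
    then show "x \<in> ?g ` ?B" using x by (intro image_eqI[of _ _ "(y, t)"]) auto
  next
    fix x assume "x \<in> ?g ` ?B"
    then obtain y t where "x = y(r := t)" "t \<in> B" "y \<in> R \<rightarrow>\<^sub>E B" "P x" by auto
    then show "x \<in> ?A" unfolding PiE_insert_eq by (auto intro!: image_eqI[of _ _ "(t, y)"])
  qed
  moreover have "inj_on (\<lambda>(y, t). y(r := t)) (SIGMA y : R \<rightarrow>\<^sub>E B. {t\<in>B. P (y(r := t))})"
  proof (rule inj_onI, clarify)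
    fix y t y' t'
    assume yt: "y \<in> R \<rightarrow>\<^sub>E B" "y' \<in> R \<rightarrow>\<^sub>E B" and eq: "y(r := t) = y'(r := t')"
    have "y i = y' i" for i
      using fun_cong[OF eq, of i] PiE_arb[OF yt(1) assms(3)] PiE_arb[OF yt(2) assms(3)]
      by (cases "i = r") simp_all
    moreover have "t = t'" using fun_cong[OF eq, of r] by simp
    ultimately show "y = y' \<and> t = t'" by (intro conjI ext)
  qed
  ultimately show ?thesis
    using assms by (simp add: card_image card_SigmaI finite_PiE)
qed

lemma cong_move:
  fixes u s a n :: nat
  assumes "n > 0"
  shows "[u + s = a] (mod n) \<longleftrightarrow> [u = a + (n - 1) * s] (mod n)"
proof -
  have "a + (n - 1) * s + s = a + n * s" using assms by (cases n) auto
  then have "[a + (n - 1) * s + s = a] (mod n)" by (simp only: cong_def mod_mult_self2)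
  then show ?thesis by (metis cong_add_rcancel_nat cong_sym cong_trans)
qed

text \<open>
  The coefficient \<open>c\<close> need not be invertible modulo \<open>n\<close>. A solution is determined by the quotient
  \<open>c * t div n\<close>, which is less than \<open>c\<close>.
\<close>
lemma card_multiples_cong_le:
  fixes c n a :: nat
  assumes "c > 0"
  shows "card {t\<in>{..<n}. [c * t = a] (mod n)} \<le> c"
proof -
  have "inj_on (\<lambda>t. c * t div n) {t\<in>{..<n}. [c * t = a] (mod n)}"
  proof (rule inj_onI, clarsimp simp: cong_def)
    fix s t assume "c * s mod n = a mod n" "c * t mod n = a mod n" "c * s div n = c * t div n"
    then have "c * s = c * t" by (metis mult_div_mod_eq)
    then show "s = t" using assms by simp
  qed
  moreover have "(\<lambda>t. c * t div n) ` {t\<in>{..<n}. [c * t = a] (mod n)} \<subseteq> {..<c}"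
    using assms by (auto intro!: less_mult_imp_div_less)
  ultimately have "card {t\<in>{..<n}. [c * t = a] (mod n)} \<le> card {..<c}"
    by (intro card_inj_on_le) auto
  then show ?thesis by simp
qed

lemma card_tuples_coeff_le:
  fixes c :: "'i \<Rightarrow> nat"
  assumes "finite R" "R \<noteq> {}" "n > 0" "\<And>r. r \<in> R \<Longrightarrow> c r \<in> {1..k}"
  shows "card {y \<in> R \<rightarrow>\<^sub>E {..<n}. [(\<Sum>r\<in>R. c r * y r) = a] (mod n)} \<le> k * n ^ (card R - 1)"
proof -
  obtain r R' where R: "R = insert r R'" "r \<notin> R'" using assms(2) by (metis all_not_in_conv mk_disjoint_insert)
  then have fin: "finite R'" using assms(1) by simp
  have "card {y \<in> R \<rightarrow>\<^sub>E {..<n}. [(\<Sum>r\<in>R. c r * y r) = a] (mod n)}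
    = (\<Sum>y\<in>R' \<rightarrow>\<^sub>E {..<n}. card {t\<in>{..<n}. [(\<Sum>i\<in>R. c i * (y(r := t)) i) = a] (mod n)})"
    unfolding R(1) using fin R by (intro card_PiE_insert_fibres) auto
  also have "\<dots> \<le> (\<Sum>y\<in>R' \<rightarrow>\<^sub>E {..<n}. k)"
  proof (intro sum_mono)
    fix y assume "y \<in> R' \<rightarrow>\<^sub>E {..<n}"
    have "(\<Sum>i\<in>R. c i * (y(r := t)) i) = c r * t + (\<Sum>i\<in>R'. c i * y i)" for t
    proof -
      have "(\<Sum>i\<in>R'. c i * (y(r := t)) i) = (\<Sum>i\<in>R'. c i * y i)" using R by (intro sum.cong) auto
      then show ?thesis using R fin by simp
    qed
    then have "card {t\<in>{..<n}. [(\<Sum>i\<in>R. c i * (y(r := t)) i) = a] (mod n)} \<le> c r"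
      using assms(3) assms(4)[of r] R by (simp only: cong_move) (intro card_multiples_cong_le, auto)
    then show "card {t\<in>{..<n}. [(\<Sum>i\<in>R. c i * (y(r := t)) i) = a] (mod n)} \<le> k"
      using assms(4)[of r] R by auto
  qed
  also have "\<dots> = k * n ^ (card R - 1)" using R fin by (simp add: card_PiE)
  finally show ?thesis .
qed

definition tuples :: "nat \<Rightarrow> nat \<Rightarrow> nat \<Rightarrow> (nat \<Rightarrow> nat) set" where
  "tuples n k a = {x \<in> {..<k} \<rightarrow>\<^sub>E {..<n}. [(\<Sum>i<k. x i) = a] (mod n)}"

definition ksets :: "nat \<Rightarrow> nat \<Rightarrow> nat \<Rightarrow> nat set set" where
  "ksets n k a = {T. T \<subseteq> {..<n} \<and> card T = k \<and> [\<Sum>T = a] (mod n)}"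

lemma finite_tuples [simp]: "finite (tuples n k a)"
  by (auto simp: tuples_def intro!: finite_PiE)

lemma finite_ksets [simp]: "finite (ksets n k a)"
  by (rule finite_subset[of _ "Pow {..<n}"]) (auto simp: ksets_def)

lemma card_tuples:
  assumes "n > 0" "k > 0"
  shows "card (tuples n k a) = n ^ (k - 1)"
proof -
  obtain l where k: "k = Suc l" using assms by (cases k) auto
  have "card (tuples n k a) = (\<Sum>y\<in>{..<l} \<rightarrow>\<^sub>E {..<n}. card {t\<in>{..<n}. [(\<Sum>i<k. (y(l := t)) i) = a] (mod n)})"
    unfolding tuples_def k lessThan_Suc by (intro card_PiE_insert_fibres) auto
  also have "\<dots> = (\<Sum>y\<in>{..<l} \<rightarrow>\<^sub>E {..<n}. 1)"
  proof (intro sum.cong refl)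
    fix y :: "nat \<Rightarrow> nat"
    have "(\<Sum>i<k. (y(l := t)) i) = t + (\<Sum>i<l. y i)" for t
      by (simp add: k)
    then have "{t\<in>{..<n}. [(\<Sum>i<k. (y(l := t)) i) = a] (mod n)} = {(a + (n - 1) * (\<Sum>i<l. y i)) mod n}"
      using assms by (simp only: cong_move) (auto simp: cong_def)
    then show "card {t\<in>{..<n}. [(\<Sum>i<k. (y(l := t)) i) = a] (mod n)} = 1" by simp
  qed
  also have "\<dots> = n ^ (k - 1)" by (simp add: k card_PiE)
  finally show ?thesis .
qed

lemma card_ksets:
  "fact k * card (ksets n k a) = card {x \<in> tuples n k a. inj_on x {..<k}}"
proof -
  have eq: "{x \<in> tuples n k a. inj_on x {..<k}} = (\<Union>T\<in>ksets n k a. {x \<in> {..<k} \<rightarrow>\<^sub>E T. inj_on x {..<k}})"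
  proof (intro equalityI subsetI)
    fix x assume x: "x \<in> {x \<in> tuples n k a. inj_on x {..<k}}"
    then have "x ` {..<k} \<in> ksets n k a"
      by (auto simp: tuples_def ksets_def card_image sum.reindex)
    moreover have "x \<in> {..<k} \<rightarrow>\<^sub>E x ` {..<k}" using x by (auto simp: tuples_def PiE_def)
    ultimately show "x \<in> (\<Union>T\<in>ksets n k a. {x \<in> {..<k} \<rightarrow>\<^sub>E T. inj_on x {..<k}})" using x by auto
  next
    fix x assume "x \<in> (\<Union>T\<in>ksets n k a. {x \<in> {..<k} \<rightarrow>\<^sub>E T. inj_on x {..<k}})"
    then obtain T where T: "T \<in> ksets n k a" "x \<in> {..<k} \<rightarrow>\<^sub>E T" "inj_on x {..<k}" by auto
    then have "finite T" by (auto simp: ksets_def intro: finite_subset)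
    then have "x ` {..<k} = T"
      using T by (intro card_subset_eq) (auto simp: ksets_def card_image)
    then have "\<Sum>T = (\<Sum>i<k. x i)" using T(3) by (auto simp: sum.reindex)
    then show "x \<in> {x \<in> tuples n k a. inj_on x {..<k}}"
      using T by (auto simp: ksets_def tuples_def PiE_def Pi_def)
  qed
  have c: "card {x \<in> {..<k} \<rightarrow>\<^sub>E T. inj_on x {..<k}} = fact k" if "T \<in> ksets n k a" for T
  proof -
    have "finite T" "card T = k" using that by (auto simp: ksets_def intro: finite_subset)
    then show ?thesis
      using card_inj_on_subset_funcset[of "{..<k}" T "{..<k}"] by (simp add: fact_prod_rev)
  qed
  have disj: "{x \<in> {..<k} \<rightarrow>\<^sub>E S. inj_on x {..<k}} \<inter> {x \<in> {..<k} \<rightarrow>\<^sub>E T. inj_on x {..<k}} = {}"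
    if "S \<in> ksets n k a" "T \<in> ksets n k a" "S \<noteq> T" for S T
  proof -
    have im: "x ` {..<k} = V" if "V \<in> ksets n k a" "x \<in> {..<k} \<rightarrow>\<^sub>E V" "inj_on x {..<k}" for x V
    proof -
      have "finite V" using that by (auto simp: ksets_def intro: finite_subset)
      then show ?thesis using that by (intro card_subset_eq) (auto simp: ksets_def card_image)
    qed
    show ?thesis
    proof (rule equals0I)
      fix x assume x: "x \<in> {x \<in> {..<k} \<rightarrow>\<^sub>E S. inj_on x {..<k}} \<inter> {x \<in> {..<k} \<rightarrow>\<^sub>E T. inj_on x {..<k}}"
      then have "x ` {..<k} = S" "x ` {..<k} = T" using im[OF that(1), of x] im[OF that(2), of x] by simp_all
      then show False using that(3) by simp
    qed
  qed
  have "card {x \<in> tuples n k a. inj_on x {..<k}} = (\<Sum>T\<in>ksets n k a. card {x \<in> {..<k} \<rightarrow>\<^sub>E T. inj_on x {..<k}})"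
    unfolding eq
  proof (intro card_UN_disjoint ballI impI)
    fix T assume "T \<in> ksets n k a"
    then have "finite T" by (auto simp: ksets_def intro: finite_subset)
    then show "finite {x \<in> {..<k} \<rightarrow>\<^sub>E T. inj_on x {..<k}}" by (auto intro!: finite_PiE)
  qed (use disj in auto)
  then show ?thesis using c by simp
qed

lemma card_ksets_le:
  assumes "n > 0" "k > 0"
  shows "fact k * card (ksets n k a) \<le> n ^ (k - 1)"
proof -
  have "card {x \<in> tuples n k a. inj_on x {..<k}} \<le> card (tuples n k a)"
    by (intro card_mono) auto
  then show ?thesis using assms by (simp add: card_ksets card_tuples)
qed

lemma card_ksets_le':
  assumes "n > 0" "k > 0"
  shows "card (ksets n k a) \<le> n ^ (k - 1)"
  using card_ksets_le[OF assms, of a] fact_ge_1[of k, where 'a=nat]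
  by (metis le_trans mult_le_mono1 mult_1)

text \<open>
  A tuple with \<open>m\<close> distinct values is a pattern of coincidences \<open>\<phi>\<close> on its indices, of which there are
  at most \<open>k ^ k\<close>, together with a tuple of \<open>m\<close> free values. The values satisfy a linear congruence
  whose coefficients are the multiplicities, which costs one of the \<open>m\<close> degrees of freedom.
\<close>
lemma card_tuples_small_image:
  assumes "n > 0" "m > 0"
  shows "card {x \<in> tuples n k a. card (x ` {..<k}) = m} \<le> k ^ k * (k * n ^ (m - 1))"
proof -
  define \<Phi> where "\<Phi> = {\<phi> \<in> {..<k} \<rightarrow>\<^sub>E {..<k}. card (\<phi> ` {..<k}) = m}"
  define c where "c \<phi> r = card {i\<in>{..<k}. \<phi> i = r}" for \<phi> :: "nat \<Rightarrow> nat" and r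
  define Y where "Y \<phi> = {y \<in> \<phi> ` {..<k} \<rightarrow>\<^sub>E {..<n}. [(\<Sum>r\<in>\<phi> ` {..<k}. c \<phi> r * y r) = a] (mod n)}" for \<phi>
  have finY: "finite (Y \<phi>)" for \<phi>
    unfolding Y_def by (rule finite_subset[OF _ finite_PiE[of "\<phi> ` {..<k}" "\<lambda>_. {..<n}"]]) auto
  have fin\<Phi>: "finite \<Phi>" by (auto simp: \<Phi>_def intro!: finite_PiE)
  have "{x \<in> tuples n k a. card (x ` {..<k}) = m} \<subseteq> (\<Union>\<phi>\<in>\<Phi>. (\<lambda>y. restrict (y \<circ> \<phi>) {..<k}) ` Y \<phi>)"
  proof
    fix x assume x: "x \<in> {x \<in> tuples n k a. card (x ` {..<k}) = m}"
    \<comment> \<open>\<open>\<phi>\<close> sends an index to a chosen representative among the indices with the same value.\<close>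
    define \<phi> where "\<phi> = restrict (\<lambda>i. inv_into {..<k} x (x i)) {..<k}"
    have im: "\<phi> ` {..<k} = inv_into {..<k} x ` (x ` {..<k})" by (auto simp: \<phi>_def)
    have "card (\<phi> ` {..<k}) = m"
      unfolding im using x by (subst card_image) (auto simp: inj_on_inv_into)
    moreover have mem: "\<phi> i \<in> {..<k}" "x (\<phi> i) = x i" if "i < k" for i
      using that inv_into_into[of "x i" x "{..<k}"] by (auto simp: \<phi>_def f_inv_into_f)
    ultimately have "\<phi> \<in> \<Phi>" by (auto simp: \<Phi>_def \<phi>_def)
    define y where "y = restrict x (\<phi> ` {..<k})"
    have "(\<Sum>r\<in>\<phi> ` {..<k}. c \<phi> r * y r) = (\<Sum>r\<in>\<phi> ` {..<k}. \<Sum>i | i \<in> {..<k} \<and> \<phi> i = r. x i)"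
    proof (intro sum.cong refl)
      fix r assume "r \<in> \<phi> ` {..<k}"
      have "(\<Sum>i | i \<in> {..<k} \<and> \<phi> i = r. x i) = (\<Sum>i | i \<in> {..<k} \<and> \<phi> i = r. y r)"
      proof (intro sum.cong refl)
        fix i assume "i \<in> {i. i \<in> {..<k} \<and> \<phi> i = r}"
        then show "x i = y r" using mem(2)[of i] by (auto simp: y_def)
      qed
      then show "c \<phi> r * y r = (\<Sum>i | i \<in> {..<k} \<and> \<phi> i = r. x i)" by (simp add: c_def)
    qed
    also have "\<dots> = (\<Sum>i<k. x i)" by (rule sum.group) auto
    finally have "y \<in> Y \<phi>"
      using x mem by (auto simp: Y_def y_def tuples_def)
    moreover have "restrict (y \<circ> \<phi>) {..<k} = x"
      proof
      fix i
      show "restrict (y \<circ> \<phi>) {..<k} i = x i"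
      proof (cases "i < k")
        case True
        then show ?thesis using mem by (simp add: y_def)
      next
        case False
        moreover have "x \<in> {..<k} \<rightarrow>\<^sub>E {..<n}" using x by (simp add: tuples_def)
        ultimately show ?thesis using PiE_arb[of x "{..<k}" "\<lambda>_. {..<n}" i] by simp
      qed
    qed
    ultimately show "x \<in> (\<Union>\<phi>\<in>\<Phi>. (\<lambda>y. restrict (y \<circ> \<phi>) {..<k}) ` Y \<phi>)"
      using \<open>\<phi> \<in> \<Phi>\<close> by force
  qed
  then have "card {x \<in> tuples n k a. card (x ` {..<k}) = m} \<le> card (\<Union>\<phi>\<in>\<Phi>. (\<lambda>y. restrict (y \<circ> \<phi>) {..<k}) ` Y \<phi>)"
    using finY fin\<Phi> by (intro card_mono) auto
  also have "\<dots> \<le> (\<Sum>\<phi>\<in>\<Phi>. card ((\<lambda>y. restrict (y \<circ> \<phi>) {..<k}) ` Y \<phi>))"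
    using fin\<Phi> by (rule card_UN_le)
  also have "\<dots> \<le> (\<Sum>\<phi>\<in>\<Phi>. k * n ^ (m - 1))"
  proof (intro sum_mono)
    fix \<phi> assume \<phi>: "\<phi> \<in> \<Phi>"
    have "card ((\<lambda>y. restrict (y \<circ> \<phi>) {..<k}) ` Y \<phi>) \<le> card (Y \<phi>)"
      using finY by (rule card_image_le)
    also have "\<dots> \<le> k * n ^ (card (\<phi> ` {..<k}) - 1)"
      unfolding Y_def
    proof (intro card_tuples_coeff_le)
      show "\<phi> ` {..<k} \<noteq> {}" using \<phi> assms by (auto simp: \<Phi>_def)
      fix r assume "r \<in> \<phi> ` {..<k}"
      then have "c \<phi> r > 0" by (auto simp: c_def card_gt_0_iff)
      moreover have "c \<phi> r \<le> card {..<k}" unfolding c_def by (intro card_mono) auto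
      ultimately show "c \<phi> r \<in> {1..k}" by auto
    qed (use assms in auto)
    finally show "card ((\<lambda>y. restrict (y \<circ> \<phi>) {..<k}) ` Y \<phi>) \<le> k * n ^ (m - 1)"
      using \<phi> by (simp add: \<Phi>_def)
  qed
  also have "\<dots> = card \<Phi> * (k * n ^ (m - 1))" by simp
  also have "card \<Phi> \<le> card ({..<k} \<rightarrow>\<^sub>E {..<k})"
    unfolding \<Phi>_def by (intro card_mono finite_PiE) auto
  then have "card \<Phi> * (k * n ^ (m - 1)) \<le> k ^ k * (k * n ^ (m - 1))"
    by (simp add: card_PiE)
  finally show ?thesis .
qed

text \<open>
  Noninjective tuples have at most \<open>k - 1\<close> distinct values, so by \<open>card_tuples_small_image\<close> they are
  only a fraction of order \<open>1 / n\<close> of all tuples with the prescribed sum.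
\<close>
lemma card_ksets_ge:
  assumes "n > 0" "k \<ge> 2"
  shows "n ^ (k - 1) \<le> fact k * card (ksets n k a) + k ^ (k + 2) * n ^ (k - 2)"
proof -
  let ?N = "\<lambda>m. {x \<in> tuples n k a. card (x ` {..<k}) = m}"
  have "tuples n k a \<subseteq> {x \<in> tuples n k a. inj_on x {..<k}} \<union> (\<Union>m\<in>{1..<k}. ?N m)"
  proof
    fix x assume x: "x \<in> tuples n k a"
    show "x \<in> {x \<in> tuples n k a. inj_on x {..<k}} \<union> (\<Union>m\<in>{1..<k}. ?N m)"
    proof (cases "inj_on x {..<k}")
      case False
      then have "card (x ` {..<k}) < k"
        using card_image_le[of "{..<k}" x] eq_card_imp_inj_on[of "{..<k}" x] by fastforce
      moreover have "card (x ` {..<k}) > 0" using assms by (simp add: card_gt_0_iff lessThan_empty_iff)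
      ultimately show ?thesis using x by auto
    qed (use x in auto)
  qed
  then have "card (tuples n k a) \<le> card ({x \<in> tuples n k a. inj_on x {..<k}} \<union> (\<Union>m\<in>{1..<k}. ?N m))"
    by (intro card_mono) auto
  also have "\<dots> \<le> card {x \<in> tuples n k a. inj_on x {..<k}} + card (\<Union>m\<in>{1..<k}. ?N m)"
    by (rule card_Un_le)
  also have "card (\<Union>m\<in>{1..<k}. ?N m) \<le> (\<Sum>m\<in>{1..<k}. card (?N m))"
    by (rule card_UN_le) auto
  also have "\<dots> \<le> (\<Sum>m\<in>{1..<k}. k ^ k * (k * n ^ (k - 2)))"
  proof (intro sum_mono)
    fix m assume m: "m \<in> {1..<k}"
    then have "card (?N m) \<le> k ^ k * (k * n ^ (m - 1))"
      using assms by (intro card_tuples_small_image) auto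
    also have "\<dots> \<le> k ^ k * (k * n ^ (k - 2))"
      using assms m by (intro mult_left_mono power_increasing) auto
    finally show "card (?N m) \<le> k ^ k * (k * n ^ (k - 2))" .
  qed
  also have "\<dots> = (k - 1) * (k ^ k * (k * n ^ (k - 2)))" by simp
  also have "\<dots> \<le> k * (k ^ k * (k * n ^ (k - 2)))" by (intro mult_right_mono) auto
  also have "\<dots> = k ^ (k + 2) * n ^ (k - 2)" by (simp add: mult_ac)
  finally show ?thesis using assms by (simp add: card_tuples card_ksets)
qed

text \<open>
  These sets turn missing residues into avoidance events: \<open>a\<close> is missing from the sumset exactly
  when the random set avoids all of them (\<open>representable_iff_supports\<close>).
\<close>
definition supports :: "nat \<Rightarrow> nat \<Rightarrow> nat \<Rightarrow> nat set set" where
  "supports n k a = (\<lambda>x. x ` {..<k}) ` tuples n k a"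

lemma finite_supports [simp]: "finite (supports n k a)"
  by (simp add: supports_def)

lemma supports_subset:
  assumes "T \<in> supports n k a" "k > 0"
  shows "T \<subseteq> {..<n}" "T \<noteq> {}" "card T \<in> {1..k}"
proof -
  obtain x where x: "x \<in> tuples n k a" "T = x ` {..<k}" using assms(1) by (auto simp: supports_def)
  then show "T \<subseteq> {..<n}" "T \<noteq> {}" using assms(2) by (auto simp: tuples_def)
  then show "card T \<in> {1..k}"
    using card_image_le[of "{..<k}" x] x by (auto simp: Suc_le_eq card_gt_0_iff)
qed

lemma representable_iff_supports:
  assumes "S \<subseteq> {..<n}"
  shows "representable k n S j \<longleftrightarrow> (\<exists>T\<in>supports n k j. T \<subseteq> S)"
proof
  assume "representable k n S j"
  then obtain x where x: "\<forall>i<k. x i \<in> S" "[j = (\<Sum>i<k. x i)] (mod n)" by (auto simp: representable_def)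
  have "restrict x {..<k} \<in> tuples n k j"
    using x assms by (auto simp: tuples_def cong_sym_eq)
  moreover have "restrict x {..<k} ` {..<k} \<subseteq> S" using x by auto
  ultimately show "\<exists>T\<in>supports n k j. T \<subseteq> S" unfolding supports_def by blast
next
  assume "\<exists>T\<in>supports n k j. T \<subseteq> S"
  then show "representable k n S j"
    by (force simp: supports_def representable_def tuples_def cong_sym_eq)
qed

lemma ksets_subset_supports: "ksets n k a \<subseteq> supports n k a"
proof
  fix T assume T: "T \<in> ksets n k a"
  then have "finite T" "card T = k" by (auto simp: ksets_def intro: finite_subset)
  then obtain h where "bij_betw h {0..<k} T" using ex_bij_betw_nat_finite by blast
  then have h: "bij_betw h {..<k} T" by (simp add: atLeast0LessThan)
  then have im: "h ` {..<k} = T" "inj_on h {..<k}" by (auto simp: bij_betw_def)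
  have "(\<Sum>i<k. h i) = \<Sum>T" using sum.reindex[OF im(2), of "\<lambda>x. x"] im(1) by simp
  then have "restrict h {..<k} \<in> tuples n k a"
    using T im by (auto simp: tuples_def ksets_def)
  moreover have "restrict h {..<k} ` {..<k} = T" using im by simp
  ultimately show "T \<in> supports n k a" unfolding supports_def by blast
qed

text \<open>
  The expected number of supports contained in the random set. Supports of full size \<open>k\<close> give the
  main term. Those of size \<open>m < k\<close> give at most a constant times \<open>p ^ m * n ^ (m - 1)\<close>, which is the
  order of the main term divided by \<open>(p * n) ^ (k - m)\<close>.
\<close>
lemma supports_weight_le:
  fixes p :: real
  assumes "n > 0" "k > 0" "0 \<le> p" "p \<le> 1" "p * real n \<ge> 1"
  shows "(\<Sum>T\<in>supports n k a. p ^ card T)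
    \<le> p ^ k * real n ^ (k - 1) / fact k + real k ^ (k + 2) * (p ^ k * real n ^ (k - 1)) / (p * real n)"
proof -
  let ?S = "\<lambda>m. {T \<in> supports n k a. card T = m}"
  have p0: "p > 0" using assms by (cases "p = 0") auto
  have "(\<Sum>T\<in>supports n k a. p ^ card T) = (\<Sum>m\<in>{1..k}. \<Sum>T\<in>?S m. p ^ card T)"
    using supports_subset(3)[of _ n k a] assms by (intro sum.group[symmetric]) auto
  also have "\<dots> = (\<Sum>m\<in>{1..k}. real (card (?S m)) * p ^ m)" by simp
  also have "{1..k} = insert k {1..<k}" using assms by auto
  also have "(\<Sum>m\<in>insert k {1..<k}. real (card (?S m)) * p ^ m)
      = real (card (?S k)) * p ^ k + (\<Sum>m\<in>{1..<k}. real (card (?S m)) * p ^ m)" by simp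
  also have "real (card (?S k)) * p ^ k \<le> p ^ k * real n ^ (k - 1) / fact k"
  proof -
    have "?S k \<subseteq> ksets n k a"
    proof
      fix T assume "T \<in> ?S k"
      then obtain x where x: "x \<in> tuples n k a" "T = x ` {..<k}" "card T = k" by (auto simp: supports_def)
      then have "inj_on x {..<k}" by (intro eq_card_imp_inj_on) auto
      then show "T \<in> ksets n k a" using x by (auto simp: tuples_def ksets_def sum.reindex)
    qed
    then have "card (?S k) \<le> card (ksets n k a)" by (intro card_mono) auto
    then have "fact k * card (?S k) \<le> n ^ (k - 1)"
      using card_ksets_le[OF assms(1,2), of a] by (meson le_trans mult_le_mono2)
    then have "real (fact k * card (?S k)) \<le> real (n ^ (k - 1))" by (simp only: of_nat_le_iff)
    then have "fact k * real (card (?S k)) \<le> real n ^ (k - 1)" by simp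
    then have "real (card (?S k)) \<le> real n ^ (k - 1) / fact k" by (simp add: field_simps)
    then have "real (card (?S k)) * p ^ k \<le> real n ^ (k - 1) / fact k * p ^ k"
      using assms by (intro mult_right_mono) auto
    then show ?thesis by (simp add: mult_ac)
  qed
  also have "(\<Sum>m\<in>{1..<k}. real (card (?S m)) * p ^ m)
     \<le> (\<Sum>m\<in>{1..<k}. real k ^ (k + 1) * (p ^ k * real n ^ (k - 1)) / (p * real n))"
  proof (intro sum_mono)
    fix m assume m: "m \<in> {1..<k}"
    have "?S m = (\<lambda>x. x ` {..<k}) ` {x \<in> tuples n k a. card (x ` {..<k}) = m}"
      by (auto simp: supports_def)
    then have "card (?S m) \<le> card {x \<in> tuples n k a. card (x ` {..<k}) = m}"
      by (simp add: card_image_le)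
    also have "\<dots> \<le> k ^ (k + 1) * n ^ (m - 1)"
      using card_tuples_small_image[of n m k a] assms m by (simp add: mult_ac)
    finally have "real (card (?S m)) \<le> real (k ^ (k + 1) * n ^ (m - 1))" by (simp only: of_nat_le_iff)
    then have "real (card (?S m)) * p ^ m \<le> real (k ^ (k + 1) * n ^ (m - 1)) * p ^ m"
      using assms by (intro mult_right_mono) auto
    also have "\<dots> = real k ^ (k + 1) * (real n ^ (m - 1) * p ^ m)" by simp
    also have "\<dots> \<le> real k ^ (k + 1) * (p ^ k * real n ^ (k - 1) / (p * real n))"
    proof (intro mult_left_mono)
    have "real n ^ (m - 1) * p ^ m = p * (p * real n) ^ (m - 1)"
      using m by (cases m) (auto simp: power_mult_distrib)
    also have "\<dots> \<le> p * (p * real n) ^ (k - 2)"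
      using m assms by (intro mult_left_mono power_increasing) auto
    also have "p * (p * real n) ^ (k - 2) = p ^ k * real n ^ (k - 1) / (p * real n)"
    proof -
      obtain l where "k = Suc (Suc l)" using m
        by (cases k; cases "k - 1") auto
      then show ?thesis using p0 assms(1) by (simp add: power_mult_distrib)
    qed
    finally show "real n ^ (m - 1) * p ^ m \<le> p ^ k * real n ^ (k - 1) / (p * real n)" .
    qed auto
    finally show "real (card (?S m)) * p ^ m \<le> real k ^ (k + 1) * (p ^ k * real n ^ (k - 1)) / (p * real n)"
      by simp
  qed
  also have "\<dots> = real (k - 1) * (real k ^ (k + 1) * (p ^ k * real n ^ (k - 1)) / (p * real n))" by simp
  also have "\<dots> \<le> real k * (real k ^ (k + 1) * (p ^ k * real n ^ (k - 1)) / (p * real n))"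
    using assms by (intro mult_right_mono) auto
  also have "\<dots> = real k ^ (k + 2) * (p ^ k * real n ^ (k - 1)) / (p * real n)" by simp
  finally show ?thesis by simp
qed

lemma card_ksets_inter_le:
  assumes "n > 0" "R \<subseteq> {..<n}" "card R < k"
  shows "card {T \<in> ksets n k b. S \<inter> T = R} \<le> n ^ (k - card R - 1)"
proof -
  have finR: "finite R" using assms finite_subset by auto
  have "card {T \<in> ksets n k b. S \<inter> T = R} \<le> card (ksets n (k - card R) (b + (n - 1) * \<Sum>R))"
  proof (rule card_inj_on_le)
    show "inj_on (\<lambda>T. T - R) {T \<in> ksets n k b. S \<inter> T = R}"
      by (rule inj_onI) blast
    show "(\<lambda>T. T - R) ` {T \<in> ksets n k b. S \<inter> T = R} \<subseteq> ksets n (k - card R) (b + (n - 1) * \<Sum>R)"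
    proof clarify
      fix T assume T: "T \<in> ksets n k b" and R: "R = S \<inter> T"
      have finT: "finite T" using T by (auto simp: ksets_def intro: finite_subset)
      have "\<Sum>T = \<Sum>(T - S \<inter> T) + \<Sum>(S \<inter> T)"
        using finT by (intro sum.subset_diff) auto
      then show "T - S \<inter> T \<in> ksets n (k - card (S \<inter> T)) (b + (n - 1) * \<Sum>(S \<inter> T))"
        using T finT assms(1) cong_move[OF assms(1), of "\<Sum>(T - S \<inter> T)" "\<Sum>(S \<inter> T)" b]
          by (auto simp: ksets_def card_Diff_subset)
    qed
  qed auto
  also have "\<dots> \<le> n ^ (k - card R - 1)" using assms by (intro card_ksets_le') auto
  finally show ?thesis .
qed

text \<open>
  Given \<open>S\<close>, a set \<open>T\<close> that meets \<open>S\<close> exactly in \<open>R\<close> is determined by its \<open>k - card R\<close> further elements,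
  and their sum is prescribed. So the pairs with a given intersection size \<open>s\<close> contribute the
  square of \<open>p ^ k * n ^ (k - 1)\<close> over \<open>(p * n) ^ s\<close>, up to a constant; the worst case is \<open>s = 1\<close>.
\<close>
lemma overlap_ksets_le:
  fixes p :: real
  assumes "n > 0" "k > 0" "0 \<le> p" "p \<le> 1" "p * real n \<ge> 1" "finite J"
  shows "overlap p (\<Union>j\<in>J. ksets n k j)
     \<le> real (card J) ^ 2 * 2 ^ k * (p ^ k * real n ^ (k - 1)) ^ 2 / (p * real n)"
proof -
  define Q where "Q = p ^ k * real n ^ (k - 1)"
  define F where "F = (\<Union>j\<in>J. ksets n k j)"
  have p0: "p > 0" using assms by (cases "p = 0") auto
  have Q0: "Q > 0" using p0 assms by (simp add: Q_def)
  have finF: "finite F" using assms by (auto simp: F_def)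
  have one: "(\<Sum>T | T \<in> ksets n k b \<and> T \<noteq> S \<and> S \<inter> T \<noteq> {}. p ^ card (S \<union> T)) \<le> 2 ^ k * (p ^ k * Q / (p * real n))"
    (is "?lhs \<le> _") if S: "S \<subseteq> {..<n}" "card S = k" for S b
  proof -
    have finS: "finite S" using S finite_subset by auto
    have "?lhs = (\<Sum>R\<in>Pow S - {{}, S}. \<Sum>T | T \<in> {T. T \<in> ksets n k b \<and> T \<noteq> S \<and> S \<inter> T \<noteq> {}} \<and> S \<inter> T = R. p ^ card (S \<union> T))"
    proof (intro sum.group[symmetric])
      show "(\<inter>) S ` {T \<in> ksets n k b. T \<noteq> S \<and> S \<inter> T \<noteq> {}} \<subseteq> Pow S - {{}, S}"
      proof clarify
        fix T assume T: "T \<in> ksets n k b" "T \<noteq> S" "S \<inter> T \<noteq> {}"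
        have "S \<inter> T \<noteq> S"
        proof
          assume "S \<inter> T = S"
          then have "S \<subseteq> T" by auto
          moreover have "finite T" "card T = k" using T by (auto simp: ksets_def intro: finite_subset)
          ultimately have "S = T" using S by (intro card_subset_eq) auto
          then show False using T by simp
        qed
        then show "S \<inter> T \<in> Pow S - {{}, S}" using T by auto
      qed
    qed (use finS in auto)
    also have "\<dots> \<le> (\<Sum>R\<in>Pow S - {{}, S}. p ^ k * Q / (p * real n))"
    proof (intro sum_mono)
      fix R assume R: "R \<in> Pow S - {{}, S}"
      then have Rc: "0 < card R" "card R < k"
        using finS S psubset_card_mono[of S R] by (auto simp: card_gt_0_iff intro: finite_subset)
      have "(\<Sum>T | T \<in> {T. T \<in> ksets n k b \<and> T \<noteq> S \<and> S \<inter> T \<noteq> {}} \<and> S \<inter> T = R. p ^ card (S \<union> T))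
         = (\<Sum>T | T \<in> {T. T \<in> ksets n k b \<and> T \<noteq> S \<and> S \<inter> T \<noteq> {}} \<and> S \<inter> T = R. p ^ (2 * k - card R))"
      proof (intro sum.cong refl)
        fix T assume "T \<in> {T \<in> {T. T \<in> ksets n k b \<and> T \<noteq> S \<and> S \<inter> T \<noteq> {}}. S \<inter> T = R}"
        then have "finite T" "card T = k" "S \<inter> T = R" by (auto simp: ksets_def intro: finite_subset)
        then have "card (S \<union> T) = 2 * k - card R" using card_Un_Int[OF finS, of T] S by simp
        then show "p ^ card (S \<union> T) = p ^ (2 * k - card R)" by simp
      qed
      also have "\<dots> \<le> (\<Sum>T | T \<in> ksets n k b \<and> S \<inter> T = R. p ^ (2 * k - card R))"
        using p0 by (intro sum_mono2) auto
      also have "\<dots> = real (card {T \<in> ksets n k b. S \<inter> T = R}) * p ^ (2 * k - card R)" by simp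
      also have "\<dots> \<le> real (n ^ (k - card R - 1)) * p ^ (2 * k - card R)"
        using p0 card_ksets_inter_le[OF assms(1), of R k b S] R S Rc
        by (intro mult_right_mono) auto
      also have "\<dots> = p ^ k * (Q / (p * real n) ^ card R)"
      proof -
        have "k - 1 = (k - card R - 1) + card R" "2 * k - card R + card R = k + k" using Rc by auto
        then have "real n ^ (k - 1) = real n ^ (k - card R - 1) * real n ^ card R"
          "p ^ (2 * k - card R) * p ^ card R = p ^ k * p ^ k" by (simp_all flip: power_add mult_2)
        then have "real (n ^ (k - card R - 1)) * p ^ (2 * k - card R) * (p * real n) ^ card R = p ^ k * Q"
          by (simp add: Q_def power_mult_distrib mult_ac)
        then show ?thesis using p0 assms by (simp add: field_simps)
      qed
      also have "\<dots> \<le> p ^ k * (Q / (p * real n) ^ 1)"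
        using Rc assms p0 Q0 by (intro mult_left_mono divide_left_mono power_increasing) auto
      finally show "(\<Sum>T | T \<in> {T. T \<in> ksets n k b \<and> T \<noteq> S \<and> S \<inter> T \<noteq> {}} \<and> S \<inter> T = R. p ^ card (S \<union> T)) \<le> p ^ k * Q / (p * real n)"
        by simp
    qed
    also have "\<dots> = real (card (Pow S - {{}, S})) * (p ^ k * Q / (p * real n))" by simp
    also have "\<dots> \<le> 2 ^ k * (p ^ k * Q / (p * real n))"
    proof (intro mult_right_mono)
      have "card (Pow S - {{}, S}) \<le> card (Pow S)" using finS by (intro card_mono) auto
      then show "real (card (Pow S - {{}, S})) \<le> 2 ^ k"
        using S finS by (metis card_Pow of_nat_le_iff of_nat_numeral of_nat_power)
    qed (use p0 Q0 assms in auto)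
    finally show ?thesis .
  qed
  have "overlap p F = (\<Sum>S\<in>F. \<Sum>T | T \<in> F \<and> T \<noteq> S \<and> S \<inter> T \<noteq> {}. p ^ card (S \<union> T))"
    by (simp add: overlap_def)
  also have "\<dots> \<le> (\<Sum>S\<in>F. real (card J) * (2 ^ k * (p ^ k * Q / (p * real n))))"
  proof (intro sum_mono)
    fix S assume "S \<in> F"
    then have S: "S \<subseteq> {..<n}" "card S = k" by (auto simp: F_def ksets_def)
    have "(\<Sum>T | T \<in> F \<and> T \<noteq> S \<and> S \<inter> T \<noteq> {}. p ^ card (S \<union> T)) =
      (\<Sum>T\<in>(\<Union>b\<in>J. {T. T \<in> ksets n k b \<and> T \<noteq> S \<and> S \<inter> T \<noteq> {}}). p ^ card (S \<union> T))"
      by (intro sum.cong) (auto simp: F_def)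
    also have "\<dots> \<le> (\<Sum>b\<in>J. \<Sum>T | T \<in> ksets n k b \<and> T \<noteq> S \<and> S \<inter> T \<noteq> {}. p ^ card (S \<union> T))"
      using p0 assms by (intro sum_UN_le) auto
    also have "\<dots> \<le> (\<Sum>b\<in>J. 2 ^ k * (p ^ k * Q / (p * real n)))"
      by (intro sum_mono one S)
    finally show "(\<Sum>T | T \<in> F \<and> T \<noteq> S \<and> S \<inter> T \<noteq> {}. p ^ card (S \<union> T)) \<le> real (card J) * (2 ^ k * (p ^ k * Q / (p * real n)))"
      by simp
  qed
  also have "\<dots> = real (card F) * (real (card J) * (2 ^ k * (p ^ k * Q / (p * real n))))" by simp
  also have "\<dots> \<le> (real (card J) * real n ^ (k - 1)) * (real (card J) * (2 ^ k * (p ^ k * Q / (p * real n))))"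
  proof (intro mult_right_mono)
    have "card F \<le> (\<Sum>j\<in>J. card (ksets n k j))" unfolding F_def using assms by (intro card_UN_le)
    also have "\<dots> \<le> (\<Sum>j\<in>J. n ^ (k - 1))" using assms by (intro sum_mono card_ksets_le') auto
    also have "\<dots> = card J * n ^ (k - 1)" by simp
    finally show "real (card F) \<le> real (card J) * real n ^ (k - 1)"
      by (metis of_nat_le_iff of_nat_mult of_nat_power)
  qed (use p0 Q0 assms in auto)
  also have "\<dots> = real (card J) ^ 2 * 2 ^ k * Q ^ 2 / (p * real n)"
    by (simp add: Q_def power2_eq_square mult_ac)
  finally show ?thesis unfolding F_def Q_def .
qed

section \<open>Missing residues\<close>

text \<open>
  Up to the factor \<open>fact k\<close>, the expected number of \<open>k\<close>-subsets of the random set with a prescribed sum.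
  The probability that a residue is missing is close to \<open>exp (- (load k n p / fact k))\<close>.
\<close>
definition load :: "nat \<Rightarrow> nat \<Rightarrow> real \<Rightarrow> real" where
  "load k n p = p ^ k * real n ^ (k - 1)"

text \<open>
  The first two summands serve the lower bound \<open>avoid_supports_lower\<close>: \<open>2\<close> for the quadratic term of the
  logarithm, the second for the supports with fewer than \<open>k\<close> elements. The upper bound
  \<open>avoid_ksets_upper\<close> uses the second summand for noninjective tuples and the third for the overlap.
\<close>
definition err_const :: "nat \<Rightarrow> real" where
  "err_const k = 2 + 3 * real k ^ (k + 2) + 2 * 2 ^ k"

definition err :: "nat \<Rightarrow> nat \<Rightarrow> real \<Rightarrow> real" where
  "err k n p = err_const k * load k n p ^ 2 / (p * real n)"

lemma err_const_pos: "err_const k > 0"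
  by (simp add: err_const_def add_pos_nonneg)

lemma prob_le_load:
  assumes "n > 0" "k \<ge> 2" "0 \<le> p" "p * real n \<ge> 1"
  shows "p \<le> load k n p / (p * real n)"
proof -
  obtain l where k: "k = Suc (Suc l)" using assms(2) by (cases k; cases "k - 1") auto
  have "p * (p * real n) = p * (p * real n) * 1" by simp
  also have "\<dots> \<le> p * (p * real n) * (p * real n) ^ l"
    using assms by (intro mult_left_mono one_le_power) auto
  also have "\<dots> = load k n p" by (simp add: load_def k power_mult_distrib mult_ac)
  finally show ?thesis using assms by (simp add: pos_le_divide_eq)
qed

lemma avoid_supports_lower:
  assumes "n > 0" "k \<ge> 2" "0 \<le> p" "p \<le> 1 / 2" "p * real n \<ge> 1" "load k n p \<ge> 1"
  shows "exp (- (load k n p / fact k) - err k n p) \<le> bexp {..<n} p (avoids (supports n k j))"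
proof -
  define Q where "Q = load k n p"
  define M where "M = Q / fact k"
  define \<eta> where "\<eta> = 1 / (p * real n)"
  define c where "c = real k ^ (k + 2)"
  have Q: "Q \<ge> 1" using assms by (simp add: Q_def)
  have \<eta>: "\<eta> \<ge> 0" using assms by (simp add: \<eta>_def)
  have M: "0 \<le> M" "M \<le> Q"
    using Q fact_ge_1[of k, where 'a=real] by (auto simp: M_def divide_le_eq mult_le_cancel_left1)
  have c: "c \<ge> 0" by (simp add: c_def)
  have p: "p \<le> Q * \<eta>" using prob_le_load[OF assms(1,2,3,5)] by (simp add: Q_def \<eta>_def)
  let ?w = "\<Sum>T\<in>supports n k j. p ^ card T"
  have w: "?w \<le> M + c * Q * \<eta>"
    using supports_weight_le[of n k p j] assms by (simp add: M_def Q_def load_def \<eta>_def c_def)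
  have "(1 + 2 * p) * ?w \<le> (1 + 2 * p) * (M + c * Q * \<eta>)"
    using w assms by (intro mult_left_mono) auto
  also have "\<dots> = M + 2 * (p * M) + c * Q * \<eta> + (2 * p) * (c * Q * \<eta>)"
    by (simp add: algebra_simps)
  also have "\<dots> \<le> M + 2 * ((Q * \<eta>) * Q) + c * Q * \<eta> + 1 * (c * Q * \<eta>)"
    using p M Q \<eta> c assms by (intro add_mono mult_mono mult_left_mono mult_right_mono order_refl) auto
  also have "\<dots> = M + 2 * (Q * Q * \<eta>) + 2 * (1 * (c * Q * \<eta>))" by simp
  also have "\<dots> \<le> M + 2 * (Q * Q * \<eta>) + 2 * (Q * (c * Q * \<eta>))"
    using Q c \<eta> by (intro add_left_mono mult_left_mono mult_right_mono) auto
  also have "\<dots> = M + (2 + 2 * c) * (Q * Q * \<eta>)" by (simp add: algebra_simps)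
  also have "\<dots> \<le> M + err_const k * (Q * Q * \<eta>)"
    using Q c \<eta> by (intro add_left_mono mult_right_mono) (auto simp: err_const_def c_def)
  also have "err_const k * (Q * Q * \<eta>) = err k n p"
    by (simp add: err_def Q_def \<eta>_def power2_eq_square)
  finally have "- (load k n p / fact k) - err k n p \<le> - ((1 + 2 * p) * ?w)"
    by (simp add: M_def Q_def)
  then have "exp (- (load k n p / fact k) - err k n p) \<le> exp (- ((1 + 2 * p) * ?w))" by simp
  also have "\<dots> \<le> bexp {..<n} p (avoids (supports n k j))"
    using assms supports_subset[of _ n k j] by (intro bexp_avoids_lower_exp) auto
  finally show ?thesis .
qed

text \<open>
  Janson's inequality for one residue or for two simultaneously. Only the \<open>k\<close>-subsets are used; for
  different residues these families are disjoint, so the exponents of two residues add up.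
\<close>
lemma avoid_ksets_upper:
  assumes "n > 0" "k \<ge> 2" "0 \<le> p" "p \<le> 1" "p * real n \<ge> 1" "load k n p \<ge> 1"
    and J: "J \<subseteq> {..<n}" "card J \<le> 2"
  shows "bexp {..<n} p (avoids (\<Union>j\<in>J. ksets n k j))
    \<le> exp (- (real (card J) * (load k n p / fact k)) + err k n p)"
proof -
  define Q where "Q = load k n p"
  define M where "M = Q / fact k"
  define \<eta> where "\<eta> = 1 / (p * real n)"
  define c where "c = real k ^ (k + 2)"
  define F where "F = (\<Union>j\<in>J. ksets n k j)"
  have Q: "Q \<ge> 1" using assms by (simp add: Q_def)
  have \<eta>: "\<eta> \<ge> 0" using assms by (simp add: \<eta>_def)
  have p0: "p > 0" using assms by (cases "p = 0") auto
  have c: "c \<ge> 0" by (simp add: c_def)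
  have finJ: "finite J" using J finite_subset by auto
  have one: "M - c * Q * \<eta> \<le> p ^ k * real (card (ksets n k j))" for j
  proof -
    have "real (n ^ (k - 1)) \<le> real (fact k * card (ksets n k j) + k ^ (k + 2) * n ^ (k - 2))"
      using card_ksets_ge[OF assms(1,2), of j] by (simp only: of_nat_le_iff)
    then have "p ^ k * real n ^ (k - 1) \<le> p ^ k * (fact k * real (card (ksets n k j)) + c * real n ^ (k - 2))"
      using p0 by (intro mult_left_mono) (auto simp: c_def)
    then have "Q \<le> fact k * (p ^ k * real (card (ksets n k j))) + c * (p ^ k * real n ^ (k - 2))"
      by (simp add: Q_def load_def algebra_simps)
    also have "p ^ k * real n ^ (k - 2) = Q / real n"
    proof -
      obtain l where "k = Suc (Suc l)" using assms(2) by (cases k; cases "k - 1") auto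
      then show ?thesis using assms by (simp add: Q_def load_def)
    qed
    also have "c * (Q / real n) \<le> c * (Q * \<eta>)"
      using c Q p0 assms by (intro mult_left_mono) (auto simp: \<eta>_def divide_simps)
    also have "c * (Q * \<eta>) = 1 * (c * (Q * \<eta>))" by simp
    also have "\<dots> \<le> fact k * (c * (Q * \<eta>))"
      using c Q \<eta> by (intro mult_right_mono) (auto simp: fact_ge_1)
    finally have "Q \<le> fact k * (p ^ k * real (card (ksets n k j)) + c * (Q * \<eta>))"
      by (simp add: algebra_simps)
    then have "M \<le> p ^ k * real (card (ksets n k j)) + c * (Q * \<eta>)"
      by (simp add: M_def divide_le_eq mult.commute)
    then show ?thesis by (simp add: mult.assoc)
  qed
  have "(\<Sum>S\<in>F. p ^ card S) = (\<Sum>j\<in>J. \<Sum>S\<in>ksets n k j. p ^ card S)"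
    unfolding F_def
  proof (intro sum.UNION_disjoint finJ ballI impI)
    fix i j assume ij: "i \<in> J" "j \<in> J" "i \<noteq> j"
    show "ksets n k i \<inter> ksets n k j = {}"
    proof (rule equals0I)
      fix T assume "T \<in> ksets n k i \<inter> ksets n k j"
      then have "[i = j] (mod n)" by (auto simp: ksets_def intro: cong_trans cong_sym)
      moreover have "i < n" "j < n" using ij J by auto
      ultimately show False using ij by (simp add: cong_def)
    qed
  qed simp
  also have "\<dots> = (\<Sum>j\<in>J. p ^ k * real (card (ksets n k j)))"
    by (intro sum.cong) (simp_all add: ksets_def)
  finally have mu: "(\<Sum>S\<in>F. p ^ card S) \<ge> real (card J) * (M - c * Q * \<eta>)"
    using sum_mono[of J "\<lambda>_. M - c * Q * \<eta>" "\<lambda>j. p ^ k * real (card (ksets n k j))"] one by simp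
  have "overlap p F \<le> real (card J) ^ 2 * 2 ^ k * Q ^ 2 * \<eta>"
    using overlap_ksets_le[of n k p J] assms finJ by (simp add: F_def Q_def load_def \<eta>_def)
  also have "\<dots> \<le> 2 ^ 2 * 2 ^ k * Q ^ 2 * \<eta>"
    using J \<eta> by (intro mult_right_mono power_mono) auto
  finally have ov: "overlap p F / 2 \<le> 2 * 2 ^ k * Q ^ 2 * \<eta>" by simp
  have "real (card J) * (c * Q * \<eta>) \<le> 2 * (c * Q * \<eta>)"
    using J c Q \<eta> by (intro mult_right_mono) auto
  also have "\<dots> \<le> 2 * (Q * (c * Q * \<eta>))"
    using mult_right_mono[OF Q, of "c * Q * \<eta>"] c Q \<eta> by simp
  finally have "- (\<Sum>S\<in>F. p ^ card S) + overlap p F / 2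
      \<le> - (real (card J) * M) + (2 * c + 2 * 2 ^ k) * (Q ^ 2 * \<eta>)"
    using mu ov by (simp add: algebra_simps power2_eq_square)
  also have "\<dots> \<le> - (real (card J) * M) + err_const k * (Q ^ 2 * \<eta>)"
    using c \<eta> by (intro add_left_mono mult_right_mono) (auto simp: err_const_def c_def)
  also have "err_const k * (Q ^ 2 * \<eta>) = err k n p"
    by (simp add: err_def Q_def \<eta>_def)
  finally have "exp (- (\<Sum>S\<in>F. p ^ card S) + overlap p F / 2) \<le> exp (- (real (card J) * M) + err k n p)"
    by simp
  moreover have "bexp {..<n} p (avoids F) \<le> exp (- (\<Sum>S\<in>F. p ^ card S) + overlap p F / 2)"
    using assms finJ by (intro janson) (auto simp: F_def ksets_def)
  ultimately show ?thesis unfolding F_def M_def Q_def by (rule order.trans[rotated])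
qed

definition missing :: "nat \<Rightarrow> nat \<Rightarrow> nat \<Rightarrow> nat set \<Rightarrow> real" where
  "missing k n j S = of_bool (\<not> representable k n S j)"

lemma num_missing_eq_sum: "real (num_missing k n S) = (\<Sum>j<n. missing k n j S)"
  by (simp add: num_missing_def missing_def sum_of_bool_eq Int_def)

lemma representable_mono: "S \<subseteq> T \<Longrightarrow> representable k n S j \<Longrightarrow> representable k n T j"
  unfolding representable_def by blast

lemma antimono_missing: "antimono (missing k n j)"
  using representable_mono by (auto simp: antimono_def missing_def)

lemma bexp_missing: "bexp {..<n} p (missing k n j) = bexp {..<n} p (avoids (supports n k j))"
  by (intro bexp_cong) (auto simp: missing_def avoids_def representable_iff_supports)

lemma prob_missing_pmf:
  assumes "0 \<le> p" "p \<le> 1"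
  shows "measure_pmf.prob (missing_pmf k n p) B = bexp {..<n} p (\<lambda>S. indicator B (num_missing k n S))"
proof -
  have "measure_pmf.prob (missing_pmf k n p) B = measure_pmf.expectation (random_subset n p) (\<lambda>S. indicator B (num_missing k n S))"
  proof -
    have "measure_pmf.prob (missing_pmf k n p) B = measure_pmf.expectation (missing_pmf k n p) (indicator B)" by simp
    then show ?thesis by (simp only: missing_pmf_def integral_map_pmf)
  qed
  then show ?thesis
    unfolding random_subset_def using expectation_random_subset[OF assms, of "{..<n}"] by simp
qed

lemma mean_missing_pmf:
  assumes "0 \<le> p" "p \<le> 1"
  shows "mean_pmf (missing_pmf k n p) = (\<Sum>j<n. bexp {..<n} p (missing k n j))"
proof -
  have "mean_pmf (missing_pmf k n p) = measure_pmf.expectation (random_subset n p) (\<lambda>S. real (num_missing k n S))"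
    unfolding mean_pmf_def missing_pmf_def by simp
  also have "\<dots> = bexp {..<n} p (\<lambda>S. real (num_missing k n S))"
    unfolding random_subset_def using expectation_random_subset[OF assms, of "{..<n}"] by simp
  also have "\<dots> = bexp {..<n} p (\<lambda>S. \<Sum>j<n. missing k n j S)"
    by (simp only: num_missing_eq_sum)
  finally show ?thesis by (simp add: bexp_sum)
qed

lemma d_TV_le: "(\<And>B. \<bar>measure_pmf.prob P B - measure_pmf.prob Q B\<bar> \<le> c) \<Longrightarrow> d_TV P Q \<le> c"
  unfolding d_TV_def by (intro cSUP_least) auto

lemma d_TV_nonneg: "0 \<le> d_TV P Q"
proof -
  have "bdd_above (range (\<lambda>B. \<bar>measure_pmf.prob P B - measure_pmf.prob Q B\<bar>))"
  proof (intro bdd_aboveI2)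
    fix B
    show "\<bar>measure_pmf.prob P B - measure_pmf.prob Q B\<bar> \<le> 1"
      using measure_pmf.prob_le_1[of P B] measure_pmf.prob_le_1[of Q B] measure_nonneg[of P B] measure_nonneg[of Q B] by linarith
  qed
  then show ?thesis unfolding d_TV_def by (rule cSUP_upper2[of _ _ "{}"]) auto
qed

text \<open>
  Both laws put mass at least \<open>1 - r\<close> on zero: one by Markov's inequality, the other because
  \<open>exp (- r) \<ge> 1 - r\<close>.
\<close>
lemma d_TV_missing_le_mean:
  fixes k n :: nat and p :: real
  assumes "0 \<le> p" "p \<le> 1"
  defines "r \<equiv> mean_pmf (missing_pmf k n p)"
  shows "d_TV (missing_pmf k n p) (poisson_law r) \<le> r"
proof (rule d_TV_le)
  fix B
  let ?X = "missing_pmf k n p" and ?Y = "poisson_law r"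
  have r0: "r \<ge> 0" unfolding r_def mean_missing_pmf[OF assms(1,2)]
    using assms by (intro sum_nonneg bexp_nonneg) (auto simp: missing_def)
  have X: "measure_pmf.prob ?X (- {0}) \<le> r"
  proof -
    have "measure_pmf.prob ?X (- {0}) \<le> bexp {..<n} p (\<lambda>S. \<Sum>j<n. missing k n j S)"
      unfolding prob_missing_pmf[OF assms(1,2)]
      unfolding num_missing_eq_sum[symmetric] using assms
      by (intro bexp_mono) (auto simp: indicator_def)
    then show ?thesis by (simp add: r_def mean_missing_pmf[OF assms(1,2)] bexp_sum)
  qed
  have c0: "measure_pmf.prob P (- {0}) = 1 - pmf P 0" for P :: "nat pmf"
    using measure_pmf.prob_compl[of "{0}" P] by (simp add: Compl_eq_Diff_UNIV measure_pmf_single)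
  have Y: "measure_pmf.prob ?Y (- {0}) \<le> r"
    unfolding c0 using r0 exp_ge_add_one_self[of "- r"] by (simp add: pmf_poisson_law)
  have key: "\<bar>measure_pmf.prob P B - indicator B 0\<bar> \<le> measure_pmf.prob P (- {0})" for P :: "nat pmf"
  proof (cases "0 \<in> B")
    case True
    have "measure_pmf.prob P {0} \<le> measure_pmf.prob P B"
      using True by (intro measure_pmf.finite_measure_mono) auto
    then show ?thesis using True measure_pmf.prob_le_1[of P B] by (simp add: c0 measure_pmf_single)
  next
    case False
    have "measure_pmf.prob P B \<le> measure_pmf.prob P (- {0})"
      using False by (intro measure_pmf.finite_measure_mono) auto
    then show ?thesis using False by simp
  qed
  show "\<bar>measure_pmf.prob ?X B - measure_pmf.prob ?Y B\<bar> \<le> r"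
    using key[of ?X] key[of ?Y] X Y measure_pmf.prob_le_1[of ?X B] measure_pmf.prob_le_1[of ?Y B]
      measure_nonneg[of ?X B] measure_nonneg[of ?Y B]
    by (cases "0 \<in> B") (auto simp: abs_le_iff simp del: measure_nonneg measure_pmf.prob_le_1)
qed

lemma mean_missing_le:
  assumes "n > 0" "k \<ge> 2" "0 \<le> p" "p \<le> 1" "p * real n \<ge> 1" "load k n p \<ge> 1" "j < n"
  shows "bexp {..<n} p (missing k n j) \<le> exp (- (load k n p / fact k) + err k n p)"
proof -
  have "bexp {..<n} p (avoids (supports n k j)) \<le> bexp {..<n} p (avoids (\<Union>j\<in>{j}. ksets n k j))"
    using assms ksets_subset_supports by (intro bexp_avoids_mono) auto
  also have "\<dots> \<le> exp (- (real (card {j}) * (load k n p / fact k)) + err k n p)"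
    using assms by (intro avoid_ksets_upper) auto
  finally show ?thesis by (simp add: bexp_missing)
qed

lemma exp_gap:
  fixes d :: real
  shows "exp d - exp (- 2 * d) \<le> 3 * d * exp d"
proof -
  have "exp (- 2 * d) = exp d * exp (- 3 * d)" by (simp flip: exp_add)
  moreover have "exp d * (1 - 3 * d) \<le> exp d * exp (- 3 * d)"
    using exp_ge_add_one_self[of "- 3 * d"] by (intro mult_left_mono) auto
  ultimately show ?thesis by (simp add: algebra_simps)
qed

text \<open>
  Individual probabilities lie between \<open>exp (- M - d)\<close> and \<open>exp (- M + d)\<close>, and joint probabilities are
  at most \<open>exp (- 2 * M + d)\<close>, so each covariance is at most \<open>exp (- 2 * M)\<close> times \<open>exp d - exp (- 2 * d)\<close>,
  which is of order \<open>d\<close>. Summed over all pairs and divided by the mean, which is at least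
  \<open>n * exp (- M - d)\<close>, this leaves a term of order \<open>d * n * exp (- M)\<close>.
\<close>
theorem d_TV_missing_bound:
  fixes k n :: nat and p :: real
  assumes "n > 0" "k \<ge> 2" "0 \<le> p" "p \<le> 1 / 2" "p * real n \<ge> 1" "load k n p \<ge> 1"
  defines "M \<equiv> load k n p / fact k" and "d \<equiv> err k n p"
  shows "d_TV (missing_pmf k n p) (poisson_law (mean_pmf (missing_pmf k n p)))
    \<le> exp (- M + d) + 3 * d * real n * exp (- M + 2 * d)"
proof (rule d_TV_le)
  fix B
  have p1: "p \<le> 1" using assms by simp
  define r where "r = mean_pmf (missing_pmf k n p)"
  define q where "q j = bexp {..<n} p (missing k n j)" for j
  define C where "C i j = bexp {..<n} p (\<lambda>S. missing k n i S * missing k n j S)" for i j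
  have q_le: "q j \<le> exp (- M + d)" if "j < n" for j
    unfolding q_def M_def d_def using assms p1 that by (intro mean_missing_le) auto
  have q_ge: "exp (- M - d) \<le> q j" for j
    unfolding q_def M_def d_def bexp_missing using assms by (intro avoid_supports_lower) auto
  have d0: "d \<ge> 0" using assms err_const_pos[of k] by (simp add: d_def err_def)
  have r: "r = (\<Sum>j<n. q j)" using mean_missing_pmf[of p k n] assms p1 by (simp add: r_def q_def)
  have "real n * exp (- M - d) = (\<Sum>j<n. exp (- M - d))" by simp
  also have "\<dots> \<le> r" unfolding r using q_ge by (intro sum_mono)
  finally have r_ge: "real n * exp (- M - d) \<le> r" .
  have r0: "r > 0" using r_ge assms(1) by (smt (verit) exp_gt_zero mult_pos_pos of_nat_0_less_iff)
  have q0: "0 \<le> q j" for j using q_ge[of j] by (smt (verit) exp_gt_zero)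
  have sq: "(\<Sum>j<n. (q j)\<^sup>2) \<le> r * exp (- M + d)"
    unfolding r sum_distrib_right power2_eq_square
    using q_le q0 by (intro sum_mono mult_left_mono) auto
  have cov: "C i j - q i * q j \<le> exp (- M) * exp (- M) * (3 * d * exp d)" if "i < n" "j < n" "i \<noteq> j" for i j
  proof -
    have "C i j \<le> bexp {..<n} p (avoids (\<Union>j\<in>{i, j}. ksets n k j))"
      unfolding C_def
    proof (intro bexp_mono)
      fix S :: "nat set" assume "S \<subseteq> {..<n}"
      then show "missing k n i S * missing k n j S \<le> avoids (\<Union>j\<in>{i, j}. ksets n k j) S"
        using ksets_subset_supports[of n k i] ksets_subset_supports[of n k j]
        by (auto simp: missing_def avoids_def representable_iff_supports)
    qed (use assms in auto)
    also have "\<dots> \<le> exp (- (real (card {i, j}) * M) + d)"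
      unfolding M_def d_def using assms that by (intro avoid_ksets_upper) auto
    also have "\<dots> = exp (- M) * exp (- M) * exp d"
      using that by (simp flip: exp_add)
    finally have "C i j \<le> exp (- M) * exp (- M) * exp d" .
    moreover have "exp (- M - d) * exp (- M - d) \<le> q i * q j"
      using q_ge q0 by (intro mult_mono) auto
    then have "exp (- M) * exp (- M) * exp (- 2 * d) \<le> q i * q j"
      by (simp flip: exp_add)
    ultimately have "C i j - q i * q j \<le> exp (- M) * exp (- M) * (exp d - exp (- 2 * d))"
      by (simp add: right_diff_distrib)
    also have "\<dots> \<le> exp (- M) * exp (- M) * (3 * d * exp d)"
      by (intro mult_left_mono exp_gap) auto
    finally show ?thesis .
  qed
  let ?G = "exp (- M) * exp (- M) * (3 * d * exp d)"
  have G0: "?G \<ge> 0" using d0 by simp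
  have "(\<Sum>j<n. \<Sum>i\<in>{..<n} - {j}. C i j - q i * q j) \<le> (\<Sum>j<n. \<Sum>i\<in>{..<n} - {j}. ?G)"
    using cov by (intro sum_mono) auto
  also have "\<dots> \<le> (\<Sum>j<n. \<Sum>i<n. ?G)"
    using G0 by (intro sum_mono sum_mono2) auto
  also have "\<dots> = (real n * exp (- M - d)) * (3 * d * real n * exp (- M + 2 * d))"
  proof -
    have "exp (- M) * exp (- M) * exp d = exp (- M - d) * exp (- M + 2 * d)" by (simp flip: exp_add)
    then have "real n * real n * (3 * d) * (exp (- M) * exp (- M) * exp d)
        = real n * real n * (3 * d) * (exp (- M - d) * exp (- M + 2 * d))" by simp
    then show ?thesis by (simp add: mult_ac)
  qed
  also have "\<dots> \<le> r * (3 * d * real n * exp (- M + 2 * d))"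
    using r_ge d0 by (intro mult_right_mono) auto
  finally have covs: "(\<Sum>j<n. \<Sum>i\<in>{..<n} - {j}. C i j - q i * q j) \<le> r * (3 * d * real n * exp (- M + 2 * d))" .
  have "\<bar>bexp {..<n} p (\<lambda>S. indicator B (card {j\<in>{..<n}. \<not> representable k n S j})) - measure_pmf.prob (poisson_law r) B\<bar>
    \<le> ((\<Sum>j<n. (q j)\<^sup>2) + (\<Sum>j<n. \<Sum>i\<in>{..<n} - {j}. C i j - q i * q j)) / r"
    unfolding q_def C_def missing_def
    using assms p1 r r0 representable_mono
    by (intro stein_chen_decreasing) (auto simp: q_def missing_def[abs_def])
  also have "\<dots> \<le> (r * exp (- M + d) + r * (3 * d * real n * exp (- M + 2 * d))) / r"
    using sq covs r0 by (intro divide_right_mono add_mono) auto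
  also have "\<dots> = exp (- M + d) + 3 * d * real n * exp (- M + 2 * d)"
    using r0 by (simp add: add_divide_distrib)
  finally show "\<bar>measure_pmf.prob (missing_pmf k n p) B - measure_pmf.prob (poisson_law (mean_pmf (missing_pmf k n p))) B\<bar>
    \<le> exp (- M + d) + 3 * d * real n * exp (- M + 2 * d)"
    using assms p1 by (simp add: prob_missing_pmf num_missing_def r_def)
qed

section \<open>Convergence\<close>

text \<open>
  The bound for \<open>err\<close> that results from \<open>load k n p \<le> 2 * fact k * ln n\<close> and \<open>p * n \<ge> n powr (1 / k)\<close>.
\<close>
definition err_rate :: "nat \<Rightarrow> nat \<Rightarrow> real" where
  "err_rate k n = 4 * err_const k * (fact k)\<^sup>2 * (ln (real n))\<^sup>2 * real n powr (- 1 / real k)"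

lemma load_powr_le:
  assumes "n > 0" "k > 0" "0 \<le> p" "load k n p \<ge> 1"
  shows "real n powr (1 / real k) \<le> p * real n"
proof -
  obtain l where k: "k = Suc l" using assms by (cases k) auto
  have "(real n powr (1 / real k)) ^ Suc l = real n powr (real k * (1 / real k))"
    using assms by (simp only: k powr_power)
  also have "\<dots> = real n" using assms by simp
  also have "\<dots> \<le> load k n p * real n" using assms by simp
  also have "\<dots> = (p * real n) ^ Suc l" by (simp add: k load_def power_mult_distrib)
  finally have "(real n powr (1 / real k)) ^ Suc l \<le> (p * real n) ^ Suc l" .
  moreover have "0 \<le> p * real n" using assms(3) by simp
  ultimately show ?thesis by (rule power_le_imp_le_base)
qed

lemma err_le_rate:
  assumes "n > 0" "k > 0" "0 \<le> p" "1 \<le> load k n p" "load k n p \<le> 2 * fact k * ln (real n)"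
  shows "err k n p \<le> err_rate k n"
proof -
  have "err k n p \<le> err_const k * (2 * fact k * ln (real n)) ^ 2 / real n powr (1 / real k)"
    unfolding err_def using assms err_const_pos[of k]
    by (intro frac_le mult_left_mono power_mono load_powr_le) (auto intro!: mult_nonneg_nonneg)
  also have "\<dots> = err_rate k n"
    by (simp add: err_rate_def powr_minus_divide power_mult_distrib)
  finally show ?thesis .
qed

lemma root_less_imp_load_gt:
  assumes "n > 0" "k > 0" "c \<ge> 0" "root k (c / real n ^ (k - 1)) < p"
  shows "c < load k n p"
proof -
  have "(root k (c / real n ^ (k - 1))) ^ k < p ^ k"
    using assms by (intro power_strict_mono) auto
  then show ?thesis using assms by (simp add: load_def divide_less_eq)
qed

lemma mean_missing_antimono:
  assumes "0 \<le> p" "p \<le> p'" "p' \<le> 1"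
  shows "mean_pmf (missing_pmf k n p') \<le> mean_pmf (missing_pmf k n p)"
  using assms by (simp add: mean_missing_pmf sum_mono bexp_antimono_prob antimono_missing)

text \<open>
  For large \<open>p\<close> the overlap term in Janson's inequality is useless. As the mean decreases in \<open>p\<close>, it is
  estimated at the smaller probability \<open>q\<close> for which \<open>load k n q / fact k = 2 * ln n\<close>.
\<close>
lemma mean_missing_supercritical:
  assumes "n \<ge> 2" "k \<ge> 2" "0 \<le> p" "p \<le> 1" "2 * fact k * ln (real n) < load k n p"
    and "1 \<le> 2 * fact k * ln (real n)"
  shows "mean_pmf (missing_pmf k n p) \<le> exp (err_rate k n) / real n"
proof -
  define c where "c = 2 * fact k * ln (real n)"
  define q where "q = root k (c / real n ^ (k - 1))"
  have c: "c \<ge> 1" using assms by (simp add: c_def)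
  have q0: "q \<ge> 0" unfolding q_def using c by (intro real_root_ge_zero divide_nonneg_nonneg) auto
  have "q ^ k = c / real n ^ (k - 1)" using c assms by (simp add: q_def)
  then have L: "load k n q = c" using assms by (simp add: load_def)
  have "q ^ k * real n ^ (k - 1) \<le> p ^ k * real n ^ (k - 1)"
    using L assms(5) by (simp add: load_def c_def)
  then have "q ^ k \<le> p ^ k" using assms by (simp add: mult_le_cancel_right)
  then have qp: "q \<le> p" using assms(2,3) power_mono_iff[of q p k] q0 by simp
  have qn: "q * real n \<ge> 1"
  proof -
    have "1 \<le> real n powr (1 / real k)" using assms by (intro ge_one_powr_ge_zero) auto
    then show ?thesis using load_powr_le[of n k q] assms L c q0 by linarith
  qed
  have "mean_pmf (missing_pmf k n p) \<le> mean_pmf (missing_pmf k n q)"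
    using q0 qp assms by (intro mean_missing_antimono) auto
  also have "\<dots> = (\<Sum>j<n. bexp {..<n} q (missing k n j))"
    using q0 qp assms by (simp add: mean_missing_pmf)
  also have "\<dots> \<le> (\<Sum>j<n. exp (- (c / fact k) + err_rate k n))"
  proof (intro sum_mono)
    fix j assume "j \<in> {..<n}"
    then have "bexp {..<n} q (missing k n j) \<le> exp (- (load k n q / fact k) + err k n q)"
      using assms q0 qp qn L c by (intro mean_missing_le) auto
    also have "\<dots> \<le> exp (- (c / fact k) + err_rate k n)"
      using err_le_rate[of n k q] assms q0 L c by (simp add: c_def)
    finally show "bexp {..<n} q (missing k n j) \<le> exp (- (c / fact k) + err_rate k n)" .
  qed
  also have "\<dots> = real n * exp (- (2 * ln (real n))) * exp (err_rate k n)"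
    by (simp add: c_def mult.assoc flip: exp_add)
  also have "exp (- (2 * ln (real n))) = 1 / (real n * real n)"
  proof -
    have "exp (- ln (real n)) = 1 / real n"
      using assms(1) by (simp only: exp_minus inverse_eq_divide) simp
    moreover have "exp (- (2 * ln (real n))) = exp (- ln (real n)) * exp (- ln (real n))"
      by (simp flip: exp_add)
    ultimately show ?thesis by simp
  qed
  finally show ?thesis using assms by simp
qed

theorem mainTheorem3:
  fixes k :: nat and A :: real and p p0 :: "nat \<Rightarrow> real"
  assumes "k \<ge> 2"
    and "A > (real k - 1) / real k"
    and "\<forall>\<^sub>F n in sequentially. p0 n > root k (A * fact k * ln (real n) / real n ^ (k - 1))"
    and "\<forall>\<^sub>F n in sequentially. p n \<in> {p0 n..1}"
  shows "(\<lambda>n. d_TV (missing_pmf k n (p n)) (poisson_law (mean_pmf (missing_pmf k n (p n)))))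
           \<longlonglongrightarrow> 0"
proof -
  define a where "a = 1 / real k"
  \<comment> \<open>The hypothesis on \<open>A\<close> enters as \<open>e > 0\<close>, which makes the sum of covariances vanish.\<close>
  define e where "e = A - 1 + a"
  define C where "C = 4 * err_const k * (fact k)\<^sup>2"
  define D where "D = err_rate k"
  have D: "D n = C * (ln (real n))\<^sup>2 * real n powr (- a)" for n
    by (simp add: D_def err_rate_def C_def a_def)
  have a: "a > 0" using assms(1) by (simp add: a_def)
  have e: "e > 0" using assms(1,2) by (simp add: e_def a_def field_simps)
  have "a \<le> 1 / 2" using assms(1) by (simp add: a_def field_simps)
  then have A: "A > 0" using e unfolding e_def by linarith
  have D0: "D \<longlonglongrightarrow> 0"
    unfolding D using a by real_asymp
  have De: "(\<lambda>n. D n * real n powr (1 - A)) \<longlonglongrightarrow> 0"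
  proof -
    have "(\<lambda>n. C * (ln (real n))\<^sup>2 * real n powr (- e)) \<longlonglongrightarrow> 0"
      using e by real_asymp
    moreover have "C * (ln (real n))\<^sup>2 * real n powr (- e) = D n * real n powr (1 - A)" for n
      by (simp add: D e_def flip: powr_add)
    ultimately show ?thesis by simp
  qed
  define b where "b n = real n powr (- A) * exp (D n) + 3 * (D n * real n powr (1 - A)) * exp (2 * D n)
      + exp (D n) / real n" for n
  have "b \<longlonglongrightarrow> 0 * exp 0 + 3 * 0 * exp (2 * 0) + exp 0 * 0"
  proof -
    have 1: "(\<lambda>n. real n powr (- A)) \<longlonglongrightarrow> 0" using A by real_asymp
    have 2: "(\<lambda>n. 1 / real n) \<longlonglongrightarrow> 0" by real_asymp
    have "(\<lambda>n. real n powr (- A) * exp (D n) + 3 * (D n * real n powr (1 - A)) * exp (2 * D n)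
      + exp (D n) * (1 / real n)) \<longlonglongrightarrow> 0 * exp 0 + 3 * 0 * exp (2 * 0) + exp 0 * 0"
      by (intro tendsto_intros 1 2 D0 De)
    then show ?thesis unfolding b_def by simp
  qed
  then have b: "b \<longlonglongrightarrow> 0" by simp
  have ev: "\<forall>\<^sub>F n in sequentially. n \<ge> 3 \<and> 1 \<le> A * ln (real n) \<and> 1 \<le> 2 * fact k * ln (real n)
      \<and> 2 * fact k * ln (real n) * real n powr (- a) \<le> 1 / 2"
  proof (intro eventually_conj)
    show "\<forall>\<^sub>F n::nat in sequentially. n \<ge> 3" by (rule eventually_ge_at_top)
    show "\<forall>\<^sub>F n in sequentially. 1 \<le> A * ln (real n)" using A by real_asymp
    have f: "(fact k :: real) > 0" by simp
    show "\<forall>\<^sub>F n in sequentially. 1 \<le> 2 * fact k * ln (real n)" using f by real_asymp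
    have "(\<lambda>n. 2 * fact k * ln (real n) * real n powr (- a)) \<longlonglongrightarrow> 0" using a f by real_asymp
    then have "\<forall>\<^sub>F n in sequentially. 2 * fact k * ln (real n) * real n powr (- a) < 1 / 2"
      by (rule order_tendstoD) simp
    then show "\<forall>\<^sub>F n in sequentially. 2 * fact k * ln (real n) * real n powr (- a) \<le> 1 / 2"
      by eventually_elim simp
  qed
  have "\<forall>\<^sub>F n in sequentially. d_TV (missing_pmf k n (p n)) (poisson_law (mean_pmf (missing_pmf k n (p n)))) \<le> b n"
    using ev assms(3,4)
  proof eventually_elim
    case (elim n)
    define L where "L = load k n (p n)"
    have n: "n \<ge> 3" and n0: "n > 0" and A1: "1 \<le> A * ln (real n)" and c1: "1 \<le> 2 * fact k * ln (real n)"
      and small: "2 * fact k * ln (real n) * real n powr (- a) \<le> 1 / 2"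
      using elim by auto
    have pr: "root k (A * fact k * ln (real n) / real n ^ (k - 1)) < p n" "p n \<le> 1" using elim by auto
    have Af: "1 \<le> A * fact k * ln (real n)"
      using mult_mono[OF A1 fact_ge_1[of k]] A1 by (simp add: mult_ac)
    have "0 \<le> root k (A * fact k * ln (real n) / real n ^ (k - 1))" using Af by (intro real_root_ge_zero divide_nonneg_nonneg) auto
    then have p0: "0 \<le> p n" using pr by linarith
    have L: "A * fact k * ln (real n) < L"
      unfolding L_def using pr Af assms(1) n by (intro root_less_imp_load_gt) auto
    have L1: "L \<ge> 1" using L Af by linarith
    have pn: "real n powr a \<le> p n * real n"
      unfolding a_def using load_powr_le[of n k "p n"] assms(1) n p0 L1 by (simp add: L_def)
    have "1 \<le> real n powr a" using n a by (intro ge_one_powr_ge_zero) auto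
    then have pn1: "p n * real n \<ge> 1" using pn by linarith
    have D_nonneg: "D n \<ge> 0" using err_const_pos[of k] by (simp add: D C_def)
    have nonneg: "0 \<le> real n powr (- A) * exp (D n)" "0 \<le> 3 * (D n * real n powr (1 - A)) * exp (2 * D n)"
      "0 \<le> exp (D n) / real n" using D_nonneg by auto
    \<comment> \<open>As \<open>2 > 1\<close>, the mean tends to zero above this threshold.\<close>
    show ?case
    proof (cases "L \<le> 2 * fact k * ln (real n)")
      case True
      have "p n \<le> L / (p n * real n)"
        unfolding L_def using assms(1) n p0 pn1 by (intro prob_le_load) auto
      also have "\<dots> \<le> 2 * fact k * ln (real n) / real n powr a"
        using True pn L1 n by (intro frac_le) auto
      also have "\<dots> \<le> 1 / 2" using small by (simp add: powr_minus_divide)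
      finally have half: "p n \<le> 1 / 2" .
      define d where "d = err k n (p n)"
      define M where "M = L / fact k"
      have d: "d \<le> D n" unfolding d_def D_def
        using True L1 p0 n assms(1) by (intro err_le_rate) (auto simp: L_def)
      have d0: "d \<ge> 0" using pn1 err_const_pos[of k] by (simp add: d_def err_def)
      have M: "A * ln (real n) \<le> M" using L by (simp add: M_def le_divide_eq mult_ac)
      have pw: "real n powr (- A) = exp (- (A * ln (real n)))" using n by (simp add: powr_def)
      have pw': "real n * real n powr (- A) = real n powr (1 - A)"
        using n by (simp add: powr_diff powr_minus_divide)
      have "d_TV (missing_pmf k n (p n)) (poisson_law (mean_pmf (missing_pmf k n (p n))))
         \<le> exp (- M + d) + 3 * d * real n * exp (- M + 2 * d)"
        unfolding M_def L_def d_def using assms(1) n p0 half pn1 L1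
        by (intro d_TV_missing_bound) (auto simp: L_def)
      also have "\<dots> \<le> exp (- (A * ln (real n)) + D n) + 3 * D n * real n * exp (- (A * ln (real n)) + 2 * D n)"
        using M d d0 by (intro add_mono mult_mono) auto
      also have "\<dots> = real n powr (- A) * exp (D n) + 3 * (D n * (real n * real n powr (- A))) * exp (2 * D n)"
        by (simp only: pw exp_add mult_ac)
      also have "\<dots> \<le> b n" unfolding pw' b_def using nonneg by simp
      finally show ?thesis .
    next
      case False
      have "d_TV (missing_pmf k n (p n)) (poisson_law (mean_pmf (missing_pmf k n (p n))))
         \<le> mean_pmf (missing_pmf k n (p n))"
        using p0 pr by (intro d_TV_missing_le_mean)
      also have "\<dots> \<le> exp (D n) / real n"
        unfolding D_def using False p0 pr n c1 assms(1)
        by (intro mean_missing_supercritical) (auto simp: L_def)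
      also have "\<dots> \<le> b n" unfolding b_def using nonneg by simp
      finally show ?thesis .
    qed
  qed
  then show ?thesis
    by (rule tendsto_sandwich[OF always_eventually[OF allI[OF d_TV_nonneg]] _ tendsto_const b])
qed

end
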